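(* Suppose that $\mathbf{C}(\mathcal{X})$ is strongly connected and that its cyclicity $\gamma$ equals the cyclicity of $\mathcal{D}(\mathcal{X})$. Let $k\ge 1$, let $\Gamma(k)=A_1\otimes\cdots\otimes A_k$ with $A_1,\dots,A_k\in\mathcal{Y}$, and denote $u^{*}_{i,\mathcal{N}_c,j}=w^{*}_{i,\mathcal{N}_c}+v^{*}_{\mathcal{N}_c,j}$. If $k$ is greater than or equal to $$\max\left(\max_{i,j\in N}\ \frac{u^{*}_{i,\mathcal{N}_c,j}-\alpha_{i,\mathcal{N}_c}-\beta_{\mathcal{N}_c,j}}{\lambda_*}+2(n-q)+\mathrm{Sch}(\gamma,q),\ \max_{i,j:\ \gamma_{i,j}>\varepsilon}\ \frac{u^{*}_{i,\mathcal{N}_c,j}-\gamma_{i,j}}{\lambda_*}+n-q+1\right),$$ then $\Gamma(k)=CS^{k\,(\mathrm{mod}\,\gamma)}R[\Gamma(k)]$.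
   Context: **Tropical algebra and digraphs.** $\mathbb{R}_{\max}=\mathbb{R}\cup\{-\infty\}$, $a\oplus b=\max(a,b)$, $a\otimes b=a+b$, $\varepsilon=-\infty$; $(A\otimes B)_{i,j}=\max_l(a_{i,l}+b_{l,j})$; matrix powers are tropical and $A^0=I$ ($0$ on the diagonal, $\varepsilon$ elsewhere). For an $n\times n$ matrix $A$, $\mathcal{D}(A)$ has nodes $1,\dots,n$ and an edge $(i,j)$ of weight $a_{i,j}$ iff $a_{i,j}\ne\varepsilon$. A walk $(i_0,\dots,i_l)$ follows edges, has length $l$ and weight the sum of its edge weights (a single node is a walk of length and weight $0$); a cycle is a walk with $i_0=i_l$, $l\ge1$; a path is a walk with no repeated node. $A$ is irreducible if $\mathcal{D}(A)$ is strongly connected. $\lambda(A)$ is the maximal mean weight (weight/length) of cycles ($\varepsilon$ if there are none). The critical digraph $\mathbf{C}(A)$ consists of all nodes and edges lying on cycles of mean weight $\lambda(A)$. The cyclicity of a strongly connected digraph is the gcd of its cycle lengths. **Standing assumptions.** $\mathcal{X}$ is a nonempty, possibly infinite, set of $n\times n$ matrices over $\mathbb{R}_{\max}$, each irreducible with finite $\lambda$; $\mathcal{Y}=\{A-\lambda(A): A\in\mathcal{X}\}$ ($\lambda(A)$ subtracted from each entry). $A^{\sup}$, $A^{\inf}$ are the entrywise supremum and infimum of the matrices in $\mathcal{Y}$; $A^{\sup}$ has all entries in $\mathbb{R}_{\max}$. All matrices of $\mathcal{X}$ and $A^{\sup}$ have the same digraph edge set, denoted $\mathcal{D}(\mathcal{X})=(N,E)$,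 and the same critical digraph, denoted $\mathbf{C}(\mathcal{X})=(\mathcal{N}_c,\mathcal{E}_c)$. For $(i,j)\in E$, $(A^{\inf})_{i,j}\neq-\infty$. For all $A\in\mathcal{Y}$: $A_{i,j}=(A^{\sup})_{i,j}=0$ for $(i,j)\in\mathcal{E}_c$, and $A_{i,j}\le0$, $(A^{\sup})_{i,j}\le 0$ for $(i,j)\notin\mathcal{E}_c$. $q=|\mathcal{N}_c|$. **CSR.** $S$ is the $n\times n$ matrix with $S_{i,j}=0$ if $(i,j)\in\mathcal{E}_c$ and $\varepsilon$ otherwise; $\gamma$ is the cyclicity of $\mathbf{C}(\mathcal{X})$; $T(S)$ is the least $T$ with $S^{l+\gamma}=S^l$ for all $l\ge T$; $t$ is any integer with $t\gamma\ge T(S)$. With $k\,(\mathrm{mod}\,\gamma)\in\{0,\dots,\gamma-1\}$, $C=\Gamma(k)\otimes S^{(t+1)\gamma-k(\mathrm{mod}\,\gamma)}$, $R=S^{(t+1)\gamma-k(\mathrm{mod}\,\gamma)}\otimes\Gamma(k)$, and $CS^{k(\mathrm{mod}\,\gamma)}R[\Gamma(k)]=C\otimes S^{k(\mathrm{mod}\,\gamma)}\otimes R$. **Trellis.** The trellis digraph $\mathcal{T}(\Gamma(k))$ has nodes $i:l$ ($i\in N$, $0\le l\le k$) and edges $(i:(l-1),\,j:l)$ of weight $(A_l)_{i,j}$ for $(i,j)\in E$, $1\le l\le k$. $w^*_{i,\mathcal{N}_c}$ is the maximal weight of walks on $\mathcal{T}(\Gamma(k))$ from $i:0$ to some $j:m$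 ($0\le m\le k$) with $j\in\mathcal{N}_c$, whose final node is its only visit to $\mathcal{N}_c$. $v^*_{\mathcal{N}_c,j}$ is the maximal weight of walks from some $i:l$ ($0\le l\le k$), $i\in\mathcal{N}_c$, to $j:k$, whose first node is its only visit to $\mathcal{N}_c$. (Maximum over the empty set is $-\infty$.) **Weights on $\mathcal{D}(A^{\sup})$.** $\alpha_{i,\mathcal{N}_c}$: maximal weight of a path on $\mathcal{D}(A^{\sup})$ from $i$ to a node of $\mathcal{N}_c$; $\beta_{\mathcal{N}_c,j}$: maximal weight of a path from a node of $\mathcal{N}_c$ to $j$; $\gamma_{i,j}$: maximal weight of a path on $\mathcal{D}(A^{\sup})$ from $i$ to $j$ avoiding $\mathcal{N}_c$ (for $i=j$: of a cycle through $i$ avoiding $\mathcal{N}_c$), $\varepsilon$ if none exists. $B^{\sup}$ is obtained from $A^{\sup}$ by setting to $\varepsilon$ all entries $(i,j)$ with $i\in\mathcal{N}_c$ or $j\in\mathcal{N}_c$; $\lambda_*$ is the maximum cycle mean of $B^{\sup}$ (it is $<0$). Conventions: if $\lambda_*=\varepsilon$, fractions with denominator $\lambda_*$ are read as $0$ (the limit $\lambda_*\to\varepsilon$); if $\lambda_*$ is finite and the numerator is $-\infty$, the fraction is $+\infty$. **Schwarz's number.** $\mathrm{Wi}(n)=(n-1)^2+1$ for $n\ge1$, $\mathrm{Wi}(0)=0$; $\mathrm{Sch}(\gamma,n)=\gamma\,\mathrm{Wi}(\lfloor n/\gamma\rfloor)+n\,(\mathrm{mod}\,\gamma)$. *)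

theory Defs
  imports "HOL-Analysis.Analysis" "Graph_Theory.Graph_Theory"
begin

section \<open>Tropical matrices\<close>

text \<open>
  The max-plus semiring is \<^typ>\<open>ereal\<close> without \<open>\<infinity>\<close>; that \<open>\<infinity>\<close> does not occur as an entry is an
  explicit assumption of the locale below.  Maxima are written as suprema in the complete lattice
  \<^typ>\<open>ereal\<close>, so that the maximum of the empty set is \<open>-\<infinity>\<close>.  The size \<open>n\<close> is \<open>CARD('n)\<close>.
\<close>

type_synonym 'n trop_mat = "ereal ^ 'n ^ 'n"

definition trop_one :: "'n::finite trop_mat" where
  "trop_one = (\<chi> i j. if i = j then 0 else -\<infinity>)"

definition trop_mult :: "'n::finite trop_mat \<Rightarrow> 'n trop_mat \<Rightarrow> 'n trop_mat" (infixl \<open>\<otimes>\<^sub>t\<close> 70) where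
  "A \<otimes>\<^sub>t B = (\<chi> i j. SUP l. A $ i $ l + B $ l $ j)"

fun trop_power :: "'n::finite trop_mat \<Rightarrow> nat \<Rightarrow> 'n trop_mat" where
  "trop_power A 0 = trop_one"
| "trop_power A (Suc m) = trop_power A m \<otimes>\<^sub>t A"

text \<open>\<open>trop_product A k\<close> is \<open>A 1 \<otimes> \<dots> \<otimes> A k\<close>; indices start at 1.\<close>

fun trop_product :: "(nat \<Rightarrow> 'n::finite trop_mat) \<Rightarrow> nat \<Rightarrow> 'n trop_mat" where
  "trop_product A 0 = trop_one"
| "trop_product A (Suc k) = trop_product A k \<otimes>\<^sub>t A (Suc k)"


section \<open>Weighted digraphs\<close>

text \<open>
  Walks are nonempty node lists (\<^const>\<open>vwalk\<close>), and paths are walks without repeated nodes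
  (\<^const>\<open>vpath\<close>); single nodes are included.  A cycle is any closed walk of positive length, not
  necessarily elementary, hence not the library's \<open>cycle\<close>.
\<close>

definition closed_vwalk :: "'v list \<Rightarrow> 'v pair_pre_digraph \<Rightarrow> bool" where
  "closed_vwalk p G \<longleftrightarrow> vwalk p (with_proj G) \<and> hd p = last p \<and> vwalk_length p \<ge> 1"

definition vwalk_weight :: "('v \<times> 'v \<Rightarrow> ereal) \<Rightarrow> 'v list \<Rightarrow> ereal" where
  "vwalk_weight w p = (\<Sum>e\<leftarrow>vwalk_arcs p. w e)"

definition vwalk_mean :: "('v \<times> 'v \<Rightarrow> ereal) \<Rightarrow> 'v list \<Rightarrow> ereal" where
  "vwalk_mean w p = vwalk_weight w p / ereal (real (vwalk_length p))"

definition cyclicity :: "'v pair_pre_digraph \<Rightarrow> nat" where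
  "cyclicity G = Gcd {vwalk_length p | p. closed_vwalk p G}"

definition mat_digraph :: "'n::finite trop_mat \<Rightarrow> 'n pair_pre_digraph" where
  "mat_digraph A = \<lparr> pverts = UNIV, parcs = {(i, j). A $ i $ j \<noteq> -\<infinity>} \<rparr>"

definition mat_weight :: "'n::finite trop_mat \<Rightarrow> 'n \<times> 'n \<Rightarrow> ereal" where
  "mat_weight A = (\<lambda>(i, j). A $ i $ j)"

definition irreducible_mat :: "'n::finite trop_mat \<Rightarrow> bool" where
  "irreducible_mat A \<longleftrightarrow> strongly_connected (with_proj (mat_digraph A))"

definition max_cycle_mean :: "'n::finite trop_mat \<Rightarrow> ereal" where
  "max_cycle_mean A = Sup {vwalk_mean (mat_weight A) p | p. closed_vwalk p (mat_digraph A)}"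

definition critical_cycle :: "'n::finite trop_mat \<Rightarrow> 'n list \<Rightarrow> bool" where
  "critical_cycle A p \<longleftrightarrow>
     closed_vwalk p (mat_digraph A) \<and> vwalk_mean (mat_weight A) p = max_cycle_mean A"

definition critical_digraph :: "'n::finite trop_mat \<Rightarrow> 'n pair_pre_digraph" where
  "critical_digraph A =
     \<lparr> pverts = {i. \<exists>p. critical_cycle A p \<and> i \<in> set p},
       parcs = {e. \<exists>p. critical_cycle A p \<and> e \<in> set (vwalk_arcs p)} \<rparr>"


section \<open>Families of matrices with a common critical digraph\<close>

definition normalize_mat :: "'n::finite trop_mat \<Rightarrow> 'n trop_mat" where
  "normalize_mat A = (\<chi> i j. A $ i $ j - max_cycle_mean A)"

definition normalized_family :: "'n::finite trop_mat set \<Rightarrow> 'n trop_mat set" where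
  "normalized_family X = normalize_mat ` X"

definition sup_mat :: "'n::finite trop_mat set \<Rightarrow> 'n trop_mat" where
  "sup_mat X = (\<chi> i j. SUP A\<in>normalized_family X. A $ i $ j)"

definition inf_mat :: "'n::finite trop_mat set \<Rightarrow> 'n trop_mat" where
  "inf_mat X = (\<chi> i j. INF A\<in>normalized_family X. A $ i $ j)"

text \<open>\<open>D\<close> and \<open>Cr\<close> are the common digraph \<open>(N, E)\<close> and the common critical digraph \<open>(N\<^sub>c, E\<^sub>c)\<close>.\<close>

locale critical_family =
  fixes X :: "'n::finite trop_mat set"
    and D Cr :: "'n pair_pre_digraph"
  assumes nonempty: "X \<noteq> {}"
    and entries: "\<And>A i j. A \<in> X \<Longrightarrow> A $ i $ j \<noteq> \<infinity>"
    and irreducible: "\<And>A. A \<in> X \<Longrightarrow> irreducible_mat A"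
    and finite_mean: "\<And>A. A \<in> X \<Longrightarrow> \<bar>max_cycle_mean A\<bar> \<noteq> \<infinity>"
    and sup_entries: "\<And>i j. sup_mat X $ i $ j \<noteq> \<infinity>"
    and digraph: "\<And>A. A \<in> X \<Longrightarrow> mat_digraph A = D"
    and digraph_sup: "mat_digraph (sup_mat X) = D"
    and critical: "\<And>A. A \<in> X \<Longrightarrow> critical_digraph A = Cr"
    and critical_sup: "critical_digraph (sup_mat X) = Cr"
    and inf_entries: "\<And>i j. (i, j) \<in> parcs D \<Longrightarrow> inf_mat X $ i $ j \<noteq> -\<infinity>"
    and crit_entries: "\<And>A i j. A \<in> normalized_family X \<Longrightarrow> (i, j) \<in> parcs Cr \<Longrightarrow>
          A $ i $ j = 0 \<and> sup_mat X $ i $ j = 0"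
    and noncrit_entries: "\<And>A i j. A \<in> normalized_family X \<Longrightarrow> (i, j) \<notin> parcs Cr \<Longrightarrow>
          A $ i $ j \<le> 0 \<and> sup_mat X $ i $ j \<le> 0"


section \<open>CSR terms\<close>

definition crit_mat :: "'n::finite pair_pre_digraph \<Rightarrow> 'n trop_mat" where
  "crit_mat Cr = (\<chi> i j. if (i, j) \<in> parcs Cr then 0 else -\<infinity>)"

definition power_transient :: "'n::finite trop_mat \<Rightarrow> nat \<Rightarrow> nat" where
  "power_transient S g = (LEAST T. \<forall>l\<ge>T. trop_power S (l + g) = trop_power S l)"

text \<open>The CSR term of a product \<open>G\<close> of \<open>k\<close> matrices; \<open>g\<close> is the cyclicity of \<open>Cr\<close>.\<close>

definition csr :: "'n::finite pair_pre_digraph \<Rightarrow> nat \<Rightarrow> nat \<Rightarrow> 'n trop_mat \<Rightarrow> 'n trop_mat" where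
  "csr Cr t k G =
     (let g = cyclicity Cr; S = crit_mat Cr;
          C = G \<otimes>\<^sub>t trop_power S ((t + 1) * g - k mod g);
          R = trop_power S ((t + 1) * g - k mod g) \<otimes>\<^sub>t G
      in C \<otimes>\<^sub>t trop_power S (k mod g) \<otimes>\<^sub>t R)"


section \<open>Optimal walks on the trellis digraph\<close>

text \<open>The trellis node \<open>i:l\<close> is the pair \<open>(i, l)\<close>.\<close>

definition trellis :: "'n::finite pair_pre_digraph \<Rightarrow> nat \<Rightarrow> ('n \<times> nat) pair_pre_digraph" where
  "trellis D k =
     \<lparr> pverts = UNIV \<times> {0..k},
       parcs = {((i, l - 1), (j, l)) | i j l. (i, j) \<in> parcs D \<and> 1 \<le> l \<and> l \<le> k} \<rparr>"

definition trellis_weight ::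
  "(nat \<Rightarrow> 'n::finite trop_mat) \<Rightarrow> ('n \<times> nat) \<times> ('n \<times> nat) \<Rightarrow> ereal" where
  "trellis_weight A = (\<lambda>((i, _), (j, l)). A l $ i $ j)"

definition opt_to_crit ::
  "'n::finite pair_pre_digraph \<Rightarrow> 'n set \<Rightarrow> (nat \<Rightarrow> 'n trop_mat) \<Rightarrow> nat \<Rightarrow> 'n \<Rightarrow> ereal" where
  "opt_to_crit D Nc A k i =
     Sup {vwalk_weight (trellis_weight A) p | p.
            vwalk p (with_proj (trellis D k)) \<and> hd p = (i, 0) \<and> fst (last p) \<in> Nc \<and>
            (\<forall>x\<in>set (butlast p). fst x \<notin> Nc)}"

definition opt_from_crit ::
  "'n::finite pair_pre_digraph \<Rightarrow> 'n set \<Rightarrow> (nat \<Rightarrow> 'n trop_mat) \<Rightarrow> nat \<Rightarrow> 'n \<Rightarrow> ereal" where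
  "opt_from_crit D Nc A k j =
     Sup {vwalk_weight (trellis_weight A) p | p.
            vwalk p (with_proj (trellis D k)) \<and> fst (hd p) \<in> Nc \<and> last p = (j, k) \<and>
            (\<forall>x\<in>set (tl p). fst x \<notin> Nc)}"


section \<open>Optimal paths on the digraph of one matrix\<close>

definition path_to_crit :: "'n::finite trop_mat \<Rightarrow> 'n set \<Rightarrow> 'n \<Rightarrow> ereal" where
  "path_to_crit A Nc i =
     Sup {vwalk_weight (mat_weight A) p | p.
            vpath p (with_proj (mat_digraph A)) \<and> hd p = i \<and> last p \<in> Nc}"

definition path_from_crit :: "'n::finite trop_mat \<Rightarrow> 'n set \<Rightarrow> 'n \<Rightarrow> ereal" where
  "path_from_crit A Nc j =
     Sup {vwalk_weight (mat_weight A) p | p.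
            vpath p (with_proj (mat_digraph A)) \<and> hd p \<in> Nc \<and> last p = j}"

definition path_avoiding :: "'n::finite trop_mat \<Rightarrow> 'n set \<Rightarrow> 'n \<Rightarrow> 'n \<Rightarrow> ereal" where
  "path_avoiding A Nc i j =
     (if i = j
      then Sup {vwalk_weight (mat_weight A) p | p.
                  closed_vwalk p (mat_digraph A) \<and> i \<in> set p \<and> set p \<inter> Nc = {}}
      else Sup {vwalk_weight (mat_weight A) p | p.
                  vpath p (with_proj (mat_digraph A)) \<and> hd p = i \<and> last p = j \<and> set p \<inter> Nc = {}})"

definition noncrit_mat :: "'n::finite trop_mat \<Rightarrow> 'n set \<Rightarrow> 'n trop_mat" where
  "noncrit_mat A Nc = (\<chi> i j. if i \<in> Nc \<or> j \<in> Nc then -\<infinity> else A $ i $ j)"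


section \<open>The bound\<close>

text \<open>
  Division by \<open>\<lambda>\<^sub>*\<close>, read as \<open>0\<close> when \<open>\<lambda>\<^sub>* = -\<infinity>\<close>.  For finite \<open>\<lambda>\<^sub>* < 0\<close> and numerator \<open>-\<infinity>\<close>, division
  on \<^typ>\<open>ereal\<close> already gives \<open>\<infinity>\<close>.
\<close>

definition quot_mean :: "ereal \<Rightarrow> ereal \<Rightarrow> ereal" where
  "quot_mean x l = (if l = -\<infinity> then 0 else x / l)"

lemma quot_mean_minus_infty: "l \<noteq> -\<infinity> \<Longrightarrow> l < 0 \<Longrightarrow> quot_mean (-\<infinity>) l = \<infinity>"
  by (cases l) (auto simp: quot_mean_def divide_ereal_def)

definition Wi :: "nat \<Rightarrow> nat" where
  "Wi n = (if n = 0 then 0 else (n - 1)\<^sup>2 + 1)"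

definition Sch :: "nat \<Rightarrow> nat \<Rightarrow> nat" where
  "Sch g n = g * Wi (n div g) + n mod g"

end

theory Submission
  imports Defs "HOL-Number_Theory.Cong"
begin

text \<open>
  Both sides are compared entrywise with \<open>u i j = w i + v j\<close>.  Since all weights are at most \<open>0\<close> and
  critical arcs weigh \<open>0\<close>, the best product walk from \<open>i\<close> into \<open>Nc\<close> weighs exactly \<open>w i\<close>: cut a walk at
  its first visit to \<open>Nc\<close>, respectively prolong an optimal one along critical arcs.  As \<open>Cr\<close> and \<open>D\<close> have
  the same cyclicity \<open>g\<close>, the cyclic classes \<open>c\<close> of \<open>Cr\<close> extend to all nodes, and the CSR term is \<open>u i j\<close>
  if \<open>c j \<equiv> c i + k (mod g)\<close> and \<open>-\<infinity>\<close> otherwise.  The product is finite only in the same positions.  Its walks that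
  visit \<open>Nc\<close> weigh at most \<open>u i j\<close>; those that avoid \<open>Nc\<close> lose at least \<open>-\<lambda>\<^sub>*\<close> per step beyond a path, so by
  the second part of the bound they weigh at most \<open>u i j\<close>.  The same decay and the first part of the bound
  show that the optimal walks into and out of \<open>Nc\<close> leave at least \<open>Sch g q\<close> levels between them, a gap
  which Schwarz's theorem fills with a critical walk.
\<close>

section \<open>Wielandt's and Schwarz's bounds\<close>

text \<open>The obstacle is to bound the CSR term by the product. The CSR term strings together two
  product walks of \<open>k\<close> steps each with a free critical walk between them, whereas the
  product must fit an entry into \<open>Nc\<close> and an exit from it into the same
  \<open>k\<close> levels, where the two optimal pieces might overlap. The first part of the bound
  excludes this: after removal of cycles each piece keeps at most \<open>n - q\<close> steps, whence
  \<open>2 * (n - q)\<close>, and since every removed step costs at least \<open>- lam\<close>, the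
  value \<open>u i j\<close> limits how many were removed. Equal cyclicity makes the remaining gap
  usable, because its length then has the residue that a critical walk requires. In the other
  inequality only walks avoiding \<open>Nc\<close> are dangerous; at least
  \<open>k - (n - q)\<close> of their steps are removable. The condition on \<open>t\<close> makes
  the inner critical walk of the CSR term long enough for the powers of \<open>S\<close> to be
  periodic. Since \<open>\<infinity> + -\<infinity>\<close> is \<open>\<infinity>\<close> in
  \<open>ereal\<close>, upper bounds by \<open>0\<close> are carried along throughout.\<close>

lemma relpow_power_mult: "(R ^^ m) ^^ n = R ^^ (m * n)" for R :: "('a \<times> 'a) set"
  by (induction n) (simp_all add: relpow_add[symmetric] add.commute)

lemma relpow_target_in:
  assumes "R \<subseteq> V \<times> V" "(u, w) \<in> R ^^ m" "u \<in> V"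
  shows "w \<in> V"
  using assms by (cases m) auto

lemma relpow_source_in:
  assumes "R \<subseteq> V \<times> V" "(u, w) \<in> R ^^ m" "w \<in> V"
  shows "u \<in> V"
  using assms by (cases m) (simp, blast dest: relpow_Suc_D2)

lemma relpow_segment:
  assumes "\<And>i. i < n \<Longrightarrow> (f i, f (Suc i)) \<in> R" "i \<le> j" "j \<le> n"
  shows "(f i, f j) \<in> R ^^ (j - i)"
  unfolding relpow_fun_conv
  by (rule exI[of _ "\<lambda>l. f (i + l)"]) (use assms in auto)

lemma relpow_split:
  assumes "(u, v) \<in> R ^^ l" "m \<le> l"
  obtains w where "(u, w) \<in> R ^^ m" "(w, v) \<in> R ^^ (l - m)"
proof -
  have "(u, v) \<in> R ^^ (m + (l - m))" using assms by simp
  then show ?thesis using that by (auto simp only: relpow_add)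
qed

text \<open>A chain generated by iterating \<open>F\<close> that stalls once stalls forever. As its
  union is \<open>V\<close>, it gains at least one element per step until it is full.\<close>

lemma increasing_chain_fills:
  fixes T :: "nat \<Rightarrow> 'a set"
  assumes fin: "finite V" and step: "\<And>k. T (Suc k) = F (T k)"
    and mono: "\<And>k. T k \<subseteq> T (Suc k)" and sub: "\<And>k. T k \<subseteq> V"
    and cover: "\<And>x. x \<in> V \<Longrightarrow> \<exists>N. x \<in> T N"
    and k: "card V \<le> card (T 0) + k"
  shows "T k = V"
proof -
  have inc: "mono T" using mono by (rule mono_iff_le_Suc[THEN iffD2, rule_format])
  have "T k = V \<or> card (T 0) + k \<le> card (T k)" for k
  proof (induction k)
    case 0
    then show ?case by simp
  next
    case (Suc k)
    show ?case
    proof (cases "T k = V")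
      case True
      then show ?thesis using mono[of k] sub[of "Suc k"] by auto
    next
      case False
      have "T (Suc k) \<noteq> T k"
      proof
        assume eq: "T (Suc k) = T k"
        have stable: "T (k + j) = T k" for j
          by (induction j) (use eq step in auto)
        have "x \<in> T k" if "x \<in> V" for x
        proof -
          obtain N where "x \<in> T N" using cover[OF \<open>x \<in> V\<close>] by auto
          then have "x \<in> T (k + N)" using monoD[OF inc, of N "k + N"] by auto
          then show ?thesis using stable by simp
        qed
        then show False using False sub[of k] by auto
      qed
      then have "T k \<subset> T (Suc k)" using mono[of k] by auto
      then have "card (T k) < card (T (Suc k))"
        using sub fin by (meson finite_subset psubset_card_mono)
      then show ?thesis using Suc False by linarith
    qed
  qed
  then have "T k = V \<or> card V \<le> card (T k)" using k le_trans by blast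
  then show ?thesis using card_seteq[OF fin sub] by blast
qed

text \<open>
  Every node reaches a shortest closed walk \<open>C\<close>, of length \<open>g\<close>, in exactly \<open>s - g\<close> steps,
  where \<open>s = card V\<close>; in \<open>R ^^ g\<close> the
  nodes of \<open>C\<close> carry loops, so they reach every node in exactly \<open>s - 1\<close> steps of \<open>R ^^ g\<close>.
\<close>

lemma wielandt_bound:
  assumes fin: "finite V" and sub: "R \<subseteq> V \<times> V"
    and prim: "\<And>u v. u \<in> V \<Longrightarrow> v \<in> V \<Longrightarrow> \<exists>N. \<forall>l\<ge>N. (u, v) \<in> R ^^ l"
    and u: "u \<in> V" and v: "v \<in> V" and h: "Wi (card V) \<le> h"
  shows "(u, v) \<in> R ^^ h"
proof -
  define s where "s = card V"
  have succ: "\<exists>w\<in>V. (x, w) \<in> R ^^ m" if x: "x \<in> V" for x m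
  proof -
    obtain N where "\<forall>l\<ge>N. (x, x) \<in> R ^^ l" using prim[OF x x] by auto
    then have "(x, x) \<in> R ^^ (max N m)" by simp
    then show ?thesis using relpow_target_in[OF sub _ x] by (metis max.cobounded2 relpow_split)
  qed
  have s0: "s \<noteq> 0" using fin u unfolding s_def by auto
  define clen where "clen = (\<lambda>l. 1 \<le> l \<and> (\<exists>c. (c, c) \<in> R ^^ l))"
  define g where "g = (LEAST l. clen l)"
  obtain N where "\<forall>l\<ge>N. (u, u) \<in> R ^^ l" using prim[OF u u] by auto
  then have "(u, u) \<in> R ^^ (N + 1)" using le_add1 by blast
  then have "clen (N + 1)" unfolding clen_def using le_add2 by blast
  then have g: "clen g" and g_least: "\<And>l. clen l \<Longrightarrow> g \<le> l"
    unfolding g_def by (auto intro: LeastI Least_le)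
  then obtain c where "(c, c) \<in> R ^^ g" and g1: "1 \<le> g" unfolding clen_def by auto
  then obtain f where f0: "f g = f 0" and f: "\<And>i. i < g \<Longrightarrow> (f i, f (Suc i)) \<in> R"
    unfolding relpow_fun_conv by auto
  have seg: "(f i, f j) \<in> R ^^ (j - i)" if "i \<le> j" "j \<le> g" for i j
    using relpow_segment[of g f R] f that by auto
  \<comment> \<open>A repeated node would enclose a shorter closed walk.\<close>
  have inj: "i = j" if "i < g" "j < g" "f i = f j" "i \<le> j" for i j
  proof (rule ccontr)
    assume "i \<noteq> j"
    then have "clen (j - i)" using seg[of i j] that unfolding clen_def by auto
    then show False using g_least[of "j - i"] that g1 by linarith
  qed
  then have inj': "inj_on f {..<g}" by (auto simp: inj_on_def) (metis nat_le_linear)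
  define C where "C = f ` {..<g}"
  have CV: "C \<subseteq> V" unfolding C_def using f sub by auto
  have cardC: "card C = g" unfolding C_def using card_image[OF inj'] by simp
  have gs: "g \<le> s" using card_mono[OF fin CV] cardC s_def by simp
  show ?thesis
  proof (cases "s = 1")
    case True
    then obtain x where V: "V = {x}" unfolding s_def by (auto simp: card_1_singleton_iff)
    then have "(x, x) \<in> R" using succ[of x 1] by auto
    then have "(x, x) \<in> R ^^ h" for h by (induction h) auto
    then show ?thesis using u v V by auto
  next
    case False
    \<comment> \<open>If the shortest closed walk met all of \<open>V\<close>, any arc other than to
      its next node would close a shorter walk. So \<open>R\<close> would be a function, and
      \<open>f 0\<close> could not reach both \<open>f 0\<close> and \<open>f 1\<close> in the same
      number of steps, as primitivity demands.\<close>
    have gs1: "g \<le> s - 1"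
    proof (rule ccontr)
      assume "\<not> ?thesis"
      then have "g = s" using gs by simp
      then have CeqV: "C = V" using card_subset_eq[OF fin CV] cardC s_def by simp
      have nxt: "j = (if i = g - 1 then 0 else Suc i)" if ij: "i < g" "j < g" "(f i, f j) \<in> R" for i j
      proof (cases "j \<le> i")
        case True
        have "(f j, f j) \<in> R ^^ (Suc (i - j))"
          using seg[of j i] True ij by auto
        then have "clen (Suc (i - j))" unfolding clen_def by auto
        then have "g \<le> Suc (i - j)" by (rule g_least)
        then show ?thesis using ij by auto
      next
        case ji: False
        have a: "(f i, f j) \<in> R ^^ 1" "(f j, f 0) \<in> R ^^ (g - j)" "(f 0, f i) \<in> R ^^ i"
          using ij seg[of j g] seg[of 0 i] f0 by auto
        have "clen (1 + (g - j) + i)"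
          using relpow_trans[OF relpow_trans[OF a(1,2)] a(3)] unfolding clen_def by auto
        then have "g \<le> 1 + (g - j) + i" by (rule g_least)
        then show ?thesis using ji ij by auto
      qed
      have uni: "y = z" if "(x, y) \<in> R" "(x, z) \<in> R" for x y z
      proof -
        have "x \<in> C" "y \<in> C" "z \<in> C" using that sub CeqV by auto
        then obtain i j l where "i < g" "j < g" "l < g" "x = f i" "y = f j" "z = f l"
          unfolding C_def by auto
        then show ?thesis using nxt[of i j] nxt[of i l] that by metis
      qed
      have 2: "1 < g" using \<open>g = s\<close> s0 False by simp
      then have V01: "f 0 \<in> V" "f 1 \<in> V" using CV unfolding C_def by auto
      obtain N0 where "\<forall>l\<ge>N0. (f 0, f 0) \<in> R ^^ l" using prim[OF V01(1,1)] by auto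
      moreover obtain N1 where "\<forall>l\<ge>N1. (f 0, f 1) \<in> R ^^ l" using prim[OF V01] by auto
      ultimately have "(f 0, f 0) \<in> R ^^ (N0 + N1)" "(f 0, f 1) \<in> R ^^ (N0 + N1)" by auto
      then have "f 0 = f 1" using relpow_right_unique[of R] uni by blast
      then show False using inj[of 0 1] 2 by simp
    qed
    have C_step: "\<exists>c'\<in>C. (c, c') \<in> R" if c: "c \<in> C" for c
    proof -
      obtain i where i: "i < g" "c = f i" using c unfolding C_def by auto
      show ?thesis
      proof (cases "Suc i < g")
        case True
        then show ?thesis using i f[of i] unfolding C_def by auto
      next
        case False
        then have "Suc i = g" using i by simp
        then have "(c, f 0) \<in> R" using i f[of i] f0 by auto
        then show ?thesis using g1 unfolding C_def by auto
      qed
    qed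
    have loop: "(c, c) \<in> R ^^ g" if c: "c \<in> C" for c
    proof -
      obtain i where i: "i < g" "c = f i" using c unfolding C_def by auto
      then have "(f i, f 0) \<in> R ^^ (g - i)" "(f 0, f i) \<in> R ^^ i"
        using seg[of i g] seg[of 0 i] f0 by auto
      from relpow_trans[OF this] show ?thesis using i by simp
    qed
    define T where "T k = {x \<in> V. \<exists>c\<in>C. (x, c) \<in> R ^^ k}" for k
    have T_fill: "T (s - g) = V"
    proof (rule increasing_chain_fills[of V T "\<lambda>S. {x. \<exists>w\<in>S. (x, w) \<in> R}"])
      show "T (Suc k) = {x. \<exists>w\<in>T k. (x, w) \<in> R}" for k
      proof -
        have "(x, c) \<in> R ^^ Suc k \<longleftrightarrow> (\<exists>w. (x, w) \<in> R \<and> (w, c) \<in> R ^^ k)" for x c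
          by (meson relpow_Suc_D2 relpow_Suc_I2)
        then show ?thesis unfolding T_def using sub by (simp del: relpow.simps) blast
      qed
      show "T k \<subseteq> T (Suc k)" for k
        unfolding T_def using C_step by (blast intro: relpow_Suc_I)
      show "\<exists>N. x \<in> T N" if "x \<in> V" for x
      proof -
        have "f 0 \<in> C" using g1 unfolding C_def by auto
        then show ?thesis using prim[OF that, of "f 0"] CV that unfolding T_def by blast
      qed
      have "T 0 = C" unfolding T_def using CV by auto
      then show "card V \<le> card (T 0) + (s - g)" using cardC s_def by simp
    qed (use fin in \<open>auto simp: T_def\<close>)
    have U_fill: "{w. (c, w) \<in> (R ^^ g) ^^ (s - 1)} = V" if c: "c \<in> C" for c
    proof (rule increasing_chain_fills[of V "\<lambda>k. {w. (c, w) \<in> (R ^^ g) ^^ k}" "\<lambda>S. (R ^^ g) `` S"])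
      show "{w. (c, w) \<in> (R ^^ g) ^^ Suc k} = (R ^^ g) `` {w. (c, w) \<in> (R ^^ g) ^^ k}" for k
        by auto
      show "{w. (c, w) \<in> (R ^^ g) ^^ k} \<subseteq> {w. (c, w) \<in> (R ^^ g) ^^ Suc k}" for k
        using relpow_Suc_I2[OF loop[OF c]] by auto
      show "{w. (c, w) \<in> (R ^^ g) ^^ k} \<subseteq> V" for k
        using relpow_target_in[OF sub, of c] c CV by (auto simp: relpow_power_mult)
      show "\<exists>N. x \<in> {w. (c, w) \<in> (R ^^ g) ^^ N}" if x: "x \<in> V" for x
      proof -
        obtain N where "\<forall>l\<ge>N. (c, x) \<in> R ^^ l" using prim[of c x] c CV x by auto
        moreover have "N \<le> g * N" using g1 by simp
        ultimately have "(c, x) \<in> (R ^^ g) ^^ N" by (simp add: relpow_power_mult)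
        then show ?thesis by blast
      qed
      show "card V \<le> card {w. (c, w) \<in> (R ^^ g) ^^ 0} + (s - 1)"
        using s_def by simp
    qed (rule fin)
    define N0 where "N0 = (s - g) + g * (s - 1)"
    \<comment> \<open>\<open>N0\<close> equals \<open>s + g * (s - 2)\<close>, and with
      \<open>g \<le> s - 1\<close> this is at most
      \<open>s + (s - 1) * (s - 2) = (s - 1)^2 + 1\<close>.\<close>
    have "N0 \<le> Wi s"
    proof -
      obtain p where p: "s = Suc (Suc p)" using False s0 by (metis One_nat_def not0_implies_Suc)
      have "g * p \<le> Suc p * p" using gs1 p by (intro mult_right_mono) auto
      then show ?thesis using gs p by (auto simp: N0_def Wi_def power2_eq_square)
    qed
    then have N0h: "N0 \<le> h" using h s_def by simp
    \<comment> \<open>The surplus \<open>h - N0\<close> is spent at the start on an arbitrary walk,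
      since from every node exactly \<open>N0\<close> steps lead to \<open>v\<close>.\<close>
    obtain w where w: "w \<in> V" "(u, w) \<in> R ^^ (h - N0)" using succ[OF u] by auto
    then obtain c where c: "c \<in> C" "(w, c) \<in> R ^^ (s - g)" using T_fill unfolding T_def by auto
    then have "(c, v) \<in> R ^^ (g * (s - 1))" using U_fill v by (auto simp: relpow_power_mult)
    from relpow_trans[OF w(2) relpow_trans[OF c(2) this]]
    show ?thesis using N0h by (simp add: N0_def)
  qed
qed

lemma cong_relpow:
  fixes c :: "'a \<Rightarrow> nat"
  assumes "\<And>a b. (a, b) \<in> E \<Longrightarrow> [c b = c a + 1] (mod g)" "(a, b) \<in> E ^^ l"
  shows "[c b = c a + l] (mod g)"
  using assms(2)
proof (induction l arbitrary: b)
  case (Suc l)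
  then obtain x where x: "(a, x) \<in> E ^^ l" "(x, b) \<in> E" by auto
  then have "[c b = c x + 1] (mod g)" "[c x = c a + l] (mod g)" using Suc assms(1) by auto
  then have "[c b = (c a + l) + 1] (mod g)" by (meson cong_add_rcancel_nat cong_trans)
  then show ?case by simp
qed simp

lemma Wi_mono: "s \<le> m \<Longrightarrow> Wi s \<le> Wi m"
  by (auto simp: Wi_def power2_eq_square intro: mult_mono)

text \<open>One unit of \<open>Wi\<close> is worth \<open>g\<close> steps in Schwarz's bound, which
  pays for walking to a smaller class wherever it lies.\<close>

lemma Wi_strict: "1 \<le> s \<Longrightarrow> s < m \<Longrightarrow> Suc (Wi s) \<le> Wi m"
  by (auto simp: Wi_def power2_eq_square Suc_le_eq intro!: mult_strict_mono)

text \<open>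
  The \<open>g\<close>-step walks inside a cyclic class of size \<open>s\<close> obey Wielandt's bound for \<open>s\<close> nodes, so it suffices
  to reach a small class early.  Either some class has fewer than \<open>card V div g\<close> nodes and is at most \<open>g\<close>
  steps away, or a class with \<open>card V div g\<close> nodes is at most \<open>card V mod g\<close> steps away, by counting.
\<close>

lemma schwarz_bound:
  fixes c :: "'a \<Rightarrow> nat"
  assumes fin: "finite V" and sub: "E \<subseteq> V \<times> V" and g: "1 \<le> g"
    and cl: "\<And>a b. (a, b) \<in> E \<Longrightarrow> [c b = c a + 1] (mod g)"
    and ev: "\<And>a b. a \<in> V \<Longrightarrow> b \<in> V \<Longrightarrow>
        \<exists>N. \<forall>l\<ge>N. [c b = c a + l] (mod g) \<longrightarrow> (a, b) \<in> E ^^ l"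
    and a: "a \<in> V" and b: "b \<in> V" and l: "Sch g (card V) \<le> l"
    and ab: "[c b = c a + l] (mod g)"
  shows "(a, b) \<in> E ^^ l"
proof -
  have cls: "[c y = c x + m] (mod g)" if "(x, y) \<in> E ^^ m" for x y m
    using cong_relpow[of E c g] cl that by blast
  have closed: "\<exists>N\<ge>m. (x, x) \<in> E ^^ N" if x: "x \<in> V" for x m
  proof -
    obtain N where "\<forall>l\<ge>N. [c x = c x + l] (mod g) \<longrightarrow> (x, x) \<in> E ^^ l" using ev[OF x x] by auto
    moreover have "[c x = c x + g * (N + m)] (mod g)" by (simp add: cong_def)
    moreover have "N + m \<le> g * (N + m)" using g by simp
    ultimately show ?thesis by (meson add_leE)
  qed
  have succ: "\<exists>w\<in>V. (x, w) \<in> E ^^ m" and pred: "\<exists>w\<in>V. (w, x) \<in> E ^^ m" if x: "x \<in> V" for x m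
  proof -
    obtain N where N: "m \<le> N" "(x, x) \<in> E ^^ N" using closed[OF x] by blast
    then show "\<exists>w\<in>V. (x, w) \<in> E ^^ m"
      using relpow_target_in[OF sub _ x] by (metis relpow_split)
    obtain w where "(w, x) \<in> E ^^ (N - (N - m))"
      using N relpow_split[of x x N E "N - m"] by auto
    then show "\<exists>w\<in>V. (w, x) \<in> E ^^ m"
      using relpow_source_in[OF sub _ x] N by auto
  qed
  define K where "K i = {v \<in> V. [c v = i] (mod g)}" for i
  have K_cong: "K i = K j" if "[i = j] (mod g)" for i j
    unfolding K_def using that by (meson cong_sym cong_trans)
  have finK: "finite (K i)" for i using fin by (auto simp: K_def)
  \<comment> \<open>\<open>c a * (g - 1)\<close> stands for \<open>- c a\<close> modulo
    \<open>g\<close>, so the bracket is a number of steps leading from the class of \<open>a\<close>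
    to the class \<open>i\<close>.\<close>
  have shift: "[c a + (i + c a * (g - 1)) = i] (mod g)" for i
  proof -
    have "c a + (i + c a * (g - 1)) = i + c a * g" using g
      by (cases g) (auto simp: algebra_simps)
    then show ?thesis unfolding cong_def by (metis mod_mult_self1)
  qed
  have K_ne: "1 \<le> card (K i)" for i
  proof -
    obtain w where "w \<in> V" "(a, w) \<in> E ^^ (i + c a * (g - 1))" using succ[OF a] by blast
    then have "w \<in> K i" using cls shift cong_trans unfolding K_def by blast
    then have "card (K i) \<noteq> 0" using finK by auto
    then show ?thesis by simp
  qed
  have core: "(x, y) \<in> E ^^ m"
    if x: "x \<in> V" and y: "y \<in> V" and xy: "[c y = c x + m] (mod g)" and m: "g * Wi (card (K (c x))) \<le> m"
    for x y m
  proof -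
    define e h where "e = m mod g" and "h = m div g"
    have m_eq: "m = g * h + e" by (simp add: e_def h_def)
    \<comment> \<open>Peeling off \<open>m mod g\<close> steps backwards from \<open>y\<close>
      leaves a multiple of \<open>g\<close>, which puts \<open>z\<close> into the class of
      \<open>x\<close>.\<close>
    obtain z where z: "z \<in> V" "(z, y) \<in> E ^^ e" using pred[OF y] by blast
    have "[c z + e = c y] (mod g)" using cls[OF z(2)] by (rule cong_sym)
    also have "[c y = c x + m] (mod g)" by (rule xy)
    also have "[c x + m = c x + e] (mod g)" by (simp add: m_eq cong_def) (metis mod_add_right_eq mod_mod_trivial mod_mult_self4)
    finally have zx: "[c z = c x] (mod g)" by (simp add: cong_add_rcancel_nat)
    define R where "R = E ^^ g \<inter> K (c x) \<times> K (c x)"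
    \<comment> \<open>A \<open>g\<close>-step walk never leaves its class, so the restriction in
      \<open>R\<close> loses no walk.\<close>
    have lift: "(p, r) \<in> R ^^ j" if p: "p \<in> K (c x)" and "(p, r) \<in> (E ^^ g) ^^ j" for p r j
      using that(2)
    proof (induction j arbitrary: r)
      case (Suc j)
      then obtain w where w: "(p, w) \<in> R ^^ j" "(w, r) \<in> E ^^ g" by auto
      have "w \<in> K (c x)" using relpow_target_in[of R "K (c x)" p w j] w(1) p R_def by auto
      moreover have "r \<in> V" using relpow_target_in[OF sub w(2)] \<open>w \<in> K (c x)\<close> K_def by auto
      moreover have "[c r = c w + g] (mod g)" using cls[OF w(2)] .
      then have "[c r = c w] (mod g)" by (simp add: cong_def)
      ultimately have "r \<in> K (c x)" unfolding K_def by (auto intro: cong_trans)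
      then show ?case using w \<open>w \<in> K (c x)\<close> by (auto simp: R_def)
    qed simp
    have "(x, z) \<in> R ^^ h"
    proof (rule wielandt_bound[of "K (c x)"])
      show "\<exists>N. \<forall>l\<ge>N. (p, r) \<in> R ^^ l" if pr: "p \<in> K (c x)" "r \<in> K (c x)" for p r
      proof -
        obtain N where N: "\<forall>l\<ge>N. [c r = c p + l] (mod g) \<longrightarrow> (p, r) \<in> E ^^ l"
          using ev[of p r] pr K_def by auto
        have "(p, r) \<in> R ^^ l" if "N \<le> l" for l
        proof (rule lift[OF pr(1)])
          have "[c r = c p] (mod g)" using pr unfolding K_def by (auto intro: cong_trans cong_sym)
          then have "[c r = c p + g * l] (mod g)" by (simp add: cong_def)
          moreover have "l \<le> g * l" using g by simp
          ultimately have "(p, r) \<in> E ^^ (g * l)" using N that by (meson le_trans)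
          then show "(p, r) \<in> (E ^^ g) ^^ l" by (simp add: relpow_power_mult)
        qed
        then show ?thesis by blast
      qed
      show "Wi (card (K (c x))) \<le> h" using m g unfolding h_def
        by (metis div_le_mono nonzero_mult_div_cancel_left not_one_le_zero)
    qed (use finK x z zx in \<open>auto simp: K_def R_def\<close>)
    moreover have "R \<subseteq> E ^^ g" by (auto simp: R_def)
    ultimately have "(x, z) \<in> (E ^^ g) ^^ h" using relpowp_mono[to_set, of R "E ^^ g"] by blast
    then have "(x, z) \<in> E ^^ (g * h)" by (simp add: relpow_power_mult)
    from relpow_trans[OF this z(2)] show ?thesis using m_eq by simp
  qed
  define m r where "m = card V div g" and "r = card V mod g"
  have Sch: "Sch g (card V) = g * Wi m + r" by (simp add: Sch_def m_def r_def)
  have rg: "r < g" using g r_def by simp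
  have "\<exists>d. d + g * Wi (card (K (c a + d))) \<le> Sch g (card V)"
  proof (cases "\<exists>i. card (K i) < m")
    case True
    then obtain i where i: "card (K i) < m" by auto
    define d where "d = (i + c a * (g - 1)) mod g"
    have "[c a + d = i] (mod g)" using shift[of i] by (simp add: d_def cong_def mod_add_right_eq)
    then have "K (c a + d) = K i" by (rule K_cong)
    moreover have "d \<le> g" using g d_def by (simp add: less_imp_le)
    moreover have "g * Suc (Wi (card (K i))) \<le> g * Wi m"
      using Wi_strict[OF K_ne i] by (rule mult_left_mono) simp
    ultimately show ?thesis using Sch by (auto intro!: exI[of _ d])
  next
    case False
    show ?thesis
    proof (cases "\<exists>d\<le>r. card (K (c a + d)) \<le> m")
      case True
      then obtain d where d: "d \<le> r" "card (K (c a + d)) \<le> m" by auto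
      have "g * Wi (card (K (c a + d))) \<le> g * Wi m" by (rule mult_left_mono[OF Wi_mono[OF d(2)]]) simp
      then have "d + g * Wi (card (K (c a + d))) \<le> Sch g (card V)"
        unfolding Sch using d(1) by linarith
      then show ?thesis by blast
    next
      case big: False
      have V: "V = (\<Union>d\<in>{..<g}. K (c a + d))"
      proof
        show "V \<subseteq> (\<Union>d\<in>{..<g}. K (c a + d))"
        proof
          fix v assume v: "v \<in> V"
          define d where "d = (c v + c a * (g - 1)) mod g"
          have "[c a + d = c v] (mod g)" using shift[of "c v"] by (simp add: d_def cong_def mod_add_right_eq)
          then have "v \<in> K (c a + d)" using v cong_sym by (auto simp: K_def)
          moreover have "d < g" using g d_def by simp
          ultimately show "v \<in> (\<Union>d\<in>{..<g}. K (c a + d))" by auto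
        qed
      qed (auto simp: K_def)
      have disj: "K (c a + d) \<inter> K (c a + d') = {}" if "d < g" "d' < g" "d \<noteq> d'" for d d'
      proof -
        have "d = d'" if "v \<in> K (c a + d)" "v \<in> K (c a + d')" for v
        proof -
          have "[c a + d = c a + d'] (mod g)" using that unfolding K_def by (auto intro: cong_trans cong_sym)
          then have "[d = d'] (mod g)" by (simp add: cong_add_lcancel_nat)
          then show ?thesis using \<open>d < g\<close> \<open>d' < g\<close> by (simp add: cong_def)
        qed
        then show ?thesis using that by auto
      qed
      \<comment> \<open>All \<open>g\<close> classes have at least \<open>m\<close> nodes and those
        with \<open>d \<le> r\<close>, which are \<open>r + 1\<close> in number, at least one more.
        This exceeds \<open>card V = g * m + r\<close>.\<close>
      have "card V = (\<Sum>d<g. card (K (c a + d)))"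
        by (subst V, rule card_UN_disjoint) (use finK disj in auto)
      also have "\<dots> \<ge> (\<Sum>d<g. m + (if d \<le> r then 1 else 0))"
        using False big by (intro sum_mono) (auto simp: not_le not_less Suc_le_eq dest: leD)
      also have "(\<Sum>d<g. m + (if d \<le> r then 1 else 0)) = g * m + card {d. d < g \<and> d \<le> r}"
        by (simp add: sum.distrib sum.If_cases Int_def)
      also have "{d. d < g \<and> d \<le> r} = {..r}" using rg by auto
      finally have "g * m + Suc r \<le> card V" by simp
      then show ?thesis by (simp add: m_def r_def)
    qed
  qed
  then obtain d where d: "d + g * Wi (card (K (c a + d))) \<le> Sch g (card V)" by auto
  obtain x where x: "x \<in> V" "(a, x) \<in> E ^^ d" using succ[OF a] by blast
  have cx: "[c x = c a + d] (mod g)" using cls[OF x(2)] .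
  have "d \<le> l" using d l by linarith
  have "[c b = (c a + d) + (l - d)] (mod g)" using ab \<open>d \<le> l\<close> by simp
  also have "[(c a + d) + (l - d) = c x + (l - d)] (mod g)"
    using cong_sym[OF cx] by (simp add: cong_add_rcancel_nat)
  finally have "(x, b) \<in> E ^^ (l - d)"
    using core[OF x(1) b] d l K_cong[OF cx] by auto
  from relpow_trans[OF x(2) this] show ?thesis using \<open>d \<le> l\<close> by simp
qed

section \<open>Additively closed sets of natural numbers\<close>

text \<open>Modulo \<open>p\<close>, \<open>p - 1\<close> copies of an element act as its negative,
  so division with remainder stays among the numbers congruent to elements of \<open>M\<close>. The
  least positive one of these divides all of \<open>M\<close>, and the gcd is a multiple of
  it.\<close>

lemma additive_nat_set_residue:
  fixes M :: "nat set"
  assumes z: "0 \<in> M" and add: "\<And>x y. x \<in> M \<Longrightarrow> y \<in> M \<Longrightarrow> x + y \<in> M" and p: "p \<in> M" "0 < p"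
  shows "\<exists>y\<in>M. [y = Gcd M] (mod p)"
proof -
  define K where "K = {x::nat. \<exists>y\<in>M. [y = x] (mod p)}"
  have mult: "n * x \<in> M" if "x \<in> M" for n x
    by (induction n) (use z add that in auto)
  have MK: "M \<subseteq> K" unfolding K_def using cong_refl by blast
  have Kadd: "x + n * w \<in> K" if "x \<in> K" "w \<in> K" for x w n
  proof -
    obtain y y' where "y \<in> M" "[y = x] (mod p)" "y' \<in> M" "[y' = w] (mod p)"
      using \<open>x \<in> K\<close> \<open>w \<in> K\<close> by (auto simp: K_def)
    then have "[y + n * y' = x + n * w] (mod p)" "y + n * y' \<in> M"
      using add mult by (auto intro: cong_add cong_scalar_left)
    then show ?thesis by (auto simp: K_def)
  qed
  define e where "e = (LEAST x. x \<in> K \<and> 0 < x)"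
  have e: "e \<in> K" "0 < e" and e_least: "\<And>x. x \<in> K \<Longrightarrow> 0 < x \<Longrightarrow> e \<le> x"
    using LeastI[of "\<lambda>x. x \<in> K \<and> 0 < x" p] p MK
    by (auto simp: e_def intro: Least_le)
  have dvd: "e dvd x" if "x \<in> K" for x
  proof -
    have "[x + (x div e * (p - 1)) * e = x mod e] (mod p)"
    proof -
      have "x + (x div e * (p - 1)) * e = x mod e + (x div e * e) * p"
        using \<open>0 < p\<close> by (cases p) (auto simp: algebra_simps)
      then show ?thesis by (simp add: cong_def)
    qed
    then have "x mod e \<in> K" using Kadd[OF \<open>x \<in> K\<close> e(1), of "x div e * (p - 1)"]
      unfolding K_def by (auto intro: cong_trans)
    then have "x mod e = 0"
      using e_least[of "x mod e"] mod_less_divisor[OF \<open>0 < e\<close>, of x] by linarith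
    then show ?thesis by auto
  qed
  then have "e dvd Gcd M" using MK by (auto intro: Gcd_greatest)
  then obtain n where "Gcd M = e * n" by auto
  moreover have "0 \<in> K" using MK z by auto
  ultimately have "Gcd M \<in> K" using Kadd[of 0 e n] e by (simp add: mult.commute)
  then show ?thesis by (auto simp: K_def)
qed

text \<open>At most \<open>p\<close> copies of an element \<open>y\<close> congruent to the gcd
  reach the residue of \<open>l\<close> modulo \<open>p\<close>; copies of \<open>p\<close> make up
  the difference. Hence the threshold \<open>p * y\<close>.\<close>

lemma additive_nat_set_cofinite:
  fixes M :: "nat set"
  assumes z: "0 \<in> M" and add: "\<And>x y. x \<in> M \<Longrightarrow> y \<in> M \<Longrightarrow> x + y \<in> M" and p: "p \<in> M" "0 < p"
  shows "\<exists>N. \<forall>l\<ge>N. Gcd M dvd l \<longrightarrow> l \<in> M"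
proof -
  have mult: "n * x \<in> M" if "x \<in> M" for n x
    by (induction n) (use z add that in auto)
  obtain y where y: "y \<in> M" "[y = Gcd M] (mod p)" using additive_nat_set_residue[OF assms] by auto
  have "l \<in> M" if l: "p * y \<le> l" "Gcd M dvd l" for l
  proof -
    obtain n where n: "l = Gcd M * n" using l by auto
    define j where "j = n mod p"
    have "[j * y = n * Gcd M] (mod p)" using y(2) by (auto simp: j_def intro: cong_mult)
    then have "[j * y = l] (mod p)" using n by (simp add: mult.commute)
    moreover have "j \<le> p" using p(2) by (simp add: j_def less_imp_le)
    then have "j * y \<le> l" using mult_le_mono1[of j p y] l(1) by linarith
    ultimately obtain i where "l = j * y + p * i"
      by (metis cong_sym cong_le_nat mult.commute add.commute)
    then show ?thesis using add mult[OF y(1), of j] mult[OF p(1), of i] by (simp add: mult.commute)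
  qed
  then show ?thesis by blast
qed

section \<open>Walks as node lists\<close>

text \<open>Relation powers carry the arguments about lengths, node lists those about weights; this
  lemma and \<open>relpow_vwalk_arcs\<close> pass between the two.\<close>

lemma vwalk_arcs_relpow:
  assumes "xs \<noteq> []" "set (vwalk_arcs xs) \<subseteq> E"
  shows "(hd xs, last xs) \<in> E ^^ (length xs - 1)"
  using assms
proof (induction xs rule: vwalk_arcs.induct)
  case (3 x y xs)
  then have "(x, y) \<in> E" "(y, last (y # xs)) \<in> E ^^ length xs" by auto
  then have "(x, last (y # xs)) \<in> E ^^ Suc (length xs)" by (rule relpow_Suc_I2)
  then show ?case by simp
qed auto

lemma relpow_vwalk_arcs:
  assumes "(a, b) \<in> E ^^ l"
  obtains xs where "length xs = Suc l" "hd xs = a" "last xs = b" "set (vwalk_arcs xs) \<subseteq> E"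
  using assms
proof (induction l arbitrary: a thesis)
  case 0
  then show ?case using "0.prems"(1)[of "[a]"] by auto
next
  case (Suc l)
  obtain w where w: "(a, w) \<in> E" "(w, b) \<in> E ^^ l" using Suc.prems(2) by (blast dest: relpow_Suc_D2)
  obtain xs where xs: "length xs = Suc l" "hd xs = w" "last xs = b" "set (vwalk_arcs xs) \<subseteq> E"
    by (rule Suc.IH[OF _ w(2)])
  moreover from xs have "xs \<noteq> []" by auto
  ultimately show ?case using Suc.prems(1)[of "a # xs"] w by auto
qed

section \<open>Cyclicity and cyclic classes\<close>

lemma cyclicity_relpow:
  assumes "parcs G \<subseteq> pverts G \<times> pverts G"
  shows "cyclicity G = Gcd {l. 1 \<le> l \<and> (\<exists>v. (v, v) \<in> parcs G ^^ l)}"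
proof -
  have "(\<exists>p. l = vwalk_length p \<and> closed_vwalk p G) \<longleftrightarrow> 1 \<le> l \<and> (\<exists>v. (v, v) \<in> parcs G ^^ l)" for l
  proof
    assume "\<exists>p. l = vwalk_length p \<and> closed_vwalk p G"
    then obtain p where p: "p \<noteq> []" "set (vwalk_arcs p) \<subseteq> parcs G" "hd p = last p"
      "l = length p - 1" "1 \<le> l"
      by (auto simp: closed_vwalk_def vwalk_def)
    then show "1 \<le> l \<and> (\<exists>v. (v, v) \<in> parcs G ^^ l)"
      using vwalk_arcs_relpow[OF p(1,2)] by auto
  next
    assume l: "1 \<le> l \<and> (\<exists>v. (v, v) \<in> parcs G ^^ l)"
    then obtain v where "(v, v) \<in> parcs G ^^ l" by auto
    then obtain xs where xs: "length xs = Suc l" "hd xs = v" "last xs = v"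
      "set (vwalk_arcs xs) \<subseteq> parcs G"
      by (rule relpow_vwalk_arcs)
    have "set ys \<subseteq> pverts G" if "2 \<le> length ys" "set (vwalk_arcs ys) \<subseteq> parcs G" for ys
      using that
    proof (induction ys rule: vwalk_arcs.induct)
      case (3 x y zs)
      then show ?case using assms by (cases zs) auto
    qed auto
    from this[of xs] xs l have "closed_vwalk xs G"
      by (auto simp: closed_vwalk_def vwalk_def)
    then show "\<exists>p. l = vwalk_length p \<and> closed_vwalk p G" using xs by (intro exI[of _ xs]) auto
  qed
  then show ?thesis unfolding cyclicity_def by simp
qed

lemma Gcd_closed_walks_pos:
  assumes "0 < p" "(v, v) \<in> E ^^ p"
  shows "0 < Gcd {l::nat. 1 \<le> l \<and> (\<exists>v. (v, v) \<in> E ^^ l)}" (is "0 < Gcd ?L")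
proof -
  have "p \<in> ?L" using assms by auto
  then have "Gcd ?L dvd p" by (rule Gcd_dvd)
  then show ?thesis by (rule dvd_pos_nat[OF assms(1)])
qed

text \<open>Every closed walk can be inserted into a round trip from \<open>z\<close>, and the trips
  with and without it differ by its length. So the gcd of the closed lengths at \<open>z\<close>
  divides \<open>g\<close>, and closed walks at \<open>z\<close> of all large multiples of
  \<open>g\<close> can be inserted into a walk from \<open>a\<close> through \<open>z\<close> to
  \<open>b\<close>.\<close>

lemma eventually_walks:
  assumes conn: "\<And>a b. a \<in> V \<Longrightarrow> b \<in> V \<Longrightarrow> \<exists>l. (a, b) \<in> E ^^ l"
    and sub: "E \<subseteq> V \<times> V"
    and z: "z \<in> V" "(z, z) \<in> E ^^ p" "0 < p"
    and g: "g = Gcd {l. 1 \<le> l \<and> (\<exists>v. (v, v) \<in> E ^^ l)}"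
    and a: "a \<in> V" and b: "b \<in> V" and l0: "(a, b) \<in> E ^^ l0"
  shows "\<exists>N. \<forall>l\<ge>N. [l = l0] (mod g) \<longrightarrow> (a, b) \<in> E ^^ l"
proof -
  define M where "M = {l. (z, z) \<in> E ^^ l}"
  have M: "0 \<in> M" "\<And>x y. x \<in> M \<Longrightarrow> y \<in> M \<Longrightarrow> x + y \<in> M" "p \<in> M"
    using z unfolding M_def by (simp, blast dest: relpow_trans, simp)
  have "Gcd M dvd l" if l: "(v, v) \<in> E ^^ l" "1 \<le> l" for v l
  proof -
    have "v \<in> V" using l sub by (cases l) auto
    then obtain l1 l2 where w: "(z, v) \<in> E ^^ l1" "(v, z) \<in> E ^^ l2" using conn z by blast
    then have "l1 + l2 \<in> M" "(l1 + l) + l2 \<in> M"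
      using relpow_trans[OF w] relpow_trans[OF relpow_trans[OF w(1) l(1)] w(2)]
      by (simp_all add: M_def)
    then have "Gcd M dvd (l1 + l) + l2 - (l1 + l2)" by (intro dvd_diff_nat Gcd_dvd)
    then show ?thesis by simp
  qed
  then have "Gcd M dvd g" unfolding g by (auto intro: Gcd_greatest)
  moreover obtain N where N: "\<And>l. N \<le> l \<Longrightarrow> Gcd M dvd l \<Longrightarrow> l \<in> M"
    using additive_nat_set_cofinite[OF M z(3)] by blast
  moreover obtain l1 l2 where w: "(a, z) \<in> E ^^ l1" "(z, b) \<in> E ^^ l2"
    using conn a b z(1) by blast
  moreover obtain l3 where r: "(b, a) \<in> E ^^ l3" using conn a b by blast
  have "(a, b) \<in> E ^^ l" if l: "N + l1 + l2 \<le> l" "[l = l0] (mod g)" for l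
  proof -
    have cl: "g dvd m" if "(v, v) \<in> E ^^ m" for v m
      using that unfolding g by (cases "m = 0") (auto intro!: Gcd_dvd)
    \<comment> \<open>A return walk from \<open>b\<close> closes both walks from \<open>a\<close>,
      which makes their lengths comparable modulo \<open>g\<close>.\<close>
    have "g dvd l0 + l3" "g dvd l1 + l2 + l3"
      using cl[OF relpow_trans[OF l0 r]] cl[OF relpow_trans[OF relpow_trans[OF w] r]] by auto
    then have "[l0 + l3 = l1 + l2 + l3] (mod g)" by (simp add: cong_def)
    then have "[l0 = l1 + l2] (mod g)" by (simp add: cong_add_rcancel_nat)
    then have "[l = l1 + l2] (mod g)" using l(2) cong_trans by blast
    then have "g dvd l - (l1 + l2)" using l(1) by (simp add: cong_altdef_nat)
    then have "l - (l1 + l2) \<in> M" using N[of "l - (l1 + l2)"] \<open>Gcd M dvd g\<close> l(1) by (auto intro: dvd_trans)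
    then have "(z, z) \<in> E ^^ (l - (l1 + l2))" by (simp add: M_def)
    from relpow_trans[OF relpow_trans[OF w(1) this] w(2)]
    show ?thesis using l(1) by (simp add: add.commute)
  qed
  then show ?thesis by blast
qed

text \<open>\<open>c v\<close> is the length of an arbitrarily chosen walk from \<open>z\<close> to
  \<open>v\<close>. Its residue does not depend on the choice: two walks into the same node become
  closed by the same return to \<open>z\<close>.\<close>

lemma cyclic_classes:
  assumes conn: "\<And>b. \<exists>l. (z, b) \<in> E ^^ l" "\<And>b. \<exists>l. (b, z) \<in> E ^^ l"
    and g: "\<And>v l. (v, v) \<in> E ^^ l \<Longrightarrow> g dvd l"
  obtains c :: "'a \<Rightarrow> nat" where "\<And>a b. (a, b) \<in> E \<Longrightarrow> [c b = c a + 1] (mod g)"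
proof -
  define c where "c v = (SOME l. (z, v) \<in> E ^^ l)" for v
  have c: "(z, v) \<in> E ^^ c v" for v unfolding c_def using conn(1) by (rule someI_ex)
  have "[c b = c a + 1] (mod g)" if ab: "(a, b) \<in> E" for a b
  proof -
    obtain m where m: "(b, z) \<in> E ^^ m" using conn(2) by blast
    have "g dvd c b + m" using g relpow_trans[OF c m] .
    moreover have "g dvd (c a + 1) + m"
      using g relpow_trans[OF relpow_Suc_I[OF c ab] m] by simp
    ultimately have "[c b + m = (c a + 1) + m] (mod g)" by (simp add: cong_def)
    then show ?thesis by (simp only: cong_add_rcancel_nat)
  qed
  then show ?thesis by (rule that)
qed

section \<open>Entries of tropical products as optimal walk weights\<close>

lemma Sup_finite_in:
  fixes S :: "'a::complete_linorder set"
  assumes "finite S" "S \<noteq> {}"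
  shows "Sup S \<in> S"
  using Max_in[OF assms] Max_Sup[OF assms] by simp

lemma trop_mult_ge: "A $ i $ l + B $ l $ j \<le> (A \<otimes>\<^sub>t B) $ i $ j"
  by (auto simp: trop_mult_def intro: SUP_upper)

lemma trop_mult_attained:
  obtains l where "(A \<otimes>\<^sub>t B) $ i $ j = A $ i $ l + B $ l $ j"
  using Sup_finite_in[of "range (\<lambda>l. A $ i $ l + B $ l $ j)"] that
  by (auto simp: trop_mult_def)

text \<open>The arc from level \<open>s\<close> to level \<open>Suc s\<close> is weighted by the factor \<open>A (Suc s)\<close>.\<close>

fun level_weight :: "(nat \<Rightarrow> 'n::finite trop_mat) \<Rightarrow> nat \<Rightarrow> 'n list \<Rightarrow> ereal" where
  "level_weight A s (x # y # xs) = A (Suc s) $ x $ y + level_weight A (Suc s) (y # xs)"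
| "level_weight A s _ = 0"

lemma level_weight_append:
  "level_weight A s (xs @ x # ys) = level_weight A s (xs @ [x]) + level_weight A (s + length xs) (x # ys)"
  by (induction A s xs rule: level_weight.induct) (auto simp: add.assoc neq_Nil_conv)

lemma level_weight_le_0:
  assumes "\<And>l x y. s < l \<Longrightarrow> l < s + length xs \<Longrightarrow> A l $ x $ y \<le> 0"
  shows "level_weight A s xs \<le> 0"
  using assms by (induction A s xs rule: level_weight.induct) (auto intro!: add_nonpos_nonpos)

lemma level_weight_zero:
  assumes "\<And>l x y. s < l \<Longrightarrow> l < s + length xs \<Longrightarrow> (x, y) \<in> E \<Longrightarrow> A l $ x $ y = 0"
    and "set (vwalk_arcs xs) \<subseteq> E"
  shows "level_weight A s xs = 0"
  using assms by (induction A s xs rule: level_weight.induct) auto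

lemma level_weight_le_vwalk_weight:
  assumes "\<And>l x y. s < l \<Longrightarrow> l < s + length xs \<Longrightarrow> A l $ x $ y \<le> M $ x $ y"
  shows "level_weight A s xs \<le> vwalk_weight (mat_weight M) xs"
  using assms
  by (induction A s xs rule: level_weight.induct)
    (auto simp: vwalk_weight_def mat_weight_def intro!: add_mono)

text \<open>The bound by \<open>0\<close> excludes \<open>\<infinity> + -\<infinity>\<close>, which
  \<open>ereal\<close> evaluates to \<open>\<infinity>\<close>. Hence a sum other than
  \<open>-\<infinity>\<close> has no summand \<open>-\<infinity>\<close>, and every step uses an
  arc.\<close>

lemma level_weight_arcs:
  assumes "\<And>l x y. s < l \<Longrightarrow> l < s + length xs \<Longrightarrow> A l $ x $ y \<le> 0"
    and "\<And>l x y. s < l \<Longrightarrow> l < s + length xs \<Longrightarrow> A l $ x $ y \<noteq> -\<infinity> \<Longrightarrow> (x, y) \<in> E"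
    and "level_weight A s xs \<noteq> -\<infinity>"
  shows "set (vwalk_arcs xs) \<subseteq> E"
  using assms
proof (induction A s xs rule: level_weight.induct)
  case (1 A s x y xs)
  have "level_weight A (Suc s) (y # xs) \<le> 0" by (rule level_weight_le_0) (use 1 in auto)
  moreover have "A (Suc s) $ x $ y \<le> 0" using 1 by auto
  ultimately have "A (Suc s) $ x $ y \<noteq> -\<infinity>" "level_weight A (Suc s) (y # xs) \<noteq> -\<infinity>"
    using 1(4) by auto
  moreover have "set (vwalk_arcs (y # xs)) \<subseteq> E"
  proof (rule 1(1))
    show "A l $ v $ w \<le> 0" if "Suc s < l" "l < Suc s + length (y # xs)" for l v w
      using 1(2)[of l v w] that by simp
    show "(v, w) \<in> E" if "Suc s < l" "l < Suc s + length (y # xs)" "A l $ v $ w \<noteq> -\<infinity>" for l v w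
      using 1(3)[of l v w] that by simp
  qed fact
  moreover have "(x, y) \<in> E" using 1(3)[of "Suc s" x y] calculation by simp
  ultimately show ?case by simp
qed auto

lemma trop_product_ge:
  assumes "length xs = Suc k"
  shows "level_weight A 0 xs \<le> trop_product A k $ hd xs $ last xs"
  using assms
proof (induction k arbitrary: xs)
  case 0
  then show ?case by (auto simp: length_Suc_conv trop_one_def)
next
  case (Suc k)
  obtain us z where us: "xs = us @ [z]" using Suc.prems by (cases xs rule: rev_cases) auto
  obtain ys y where "us = ys @ [y]" using Suc.prems us by (cases us rule: rev_cases) auto
  then have xs: "xs = ys @ [y, z]" using us by simp
  have "level_weight A 0 xs = level_weight A 0 (ys @ [y]) + A (Suc k) $ y $ z"
    using Suc.prems by (simp add: xs level_weight_append[of A 0 ys y "[z]"])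
  also have "\<dots> \<le> trop_product A k $ hd (ys @ [y]) $ y + A (Suc k) $ y $ z"
    using Suc.IH[of "ys @ [y]"] Suc.prems by (intro add_right_mono) (simp add: xs)
  also have "\<dots> \<le> trop_product A (Suc k) $ hd (ys @ [y]) $ z"
    by (simp add: trop_mult_ge)
  also have "hd (ys @ [y]) = hd xs" by (simp add: xs hd_append)
  finally show ?case by (simp add: xs)
qed

text \<open>As no factor contains \<open>\<infinity>\<close>, the optimal inner index of a sum other
  than \<open>-\<infinity>\<close> belongs to an entry other than \<open>-\<infinity>\<close> of the
  shorter product, which the induction turns into a walk.\<close>

lemma trop_product_attained:
  assumes "\<And>l x y. 1 \<le> l \<Longrightarrow> l \<le> k \<Longrightarrow> A l $ x $ y \<noteq> \<infinity>"
    and "trop_product A k $ i $ j \<noteq> -\<infinity>"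
  shows "\<exists>xs. length xs = Suc k \<and> hd xs = i \<and> last xs = j \<and> level_weight A 0 xs = trop_product A k $ i $ j"
  using assms
proof (induction k arbitrary: j)
  case 0
  then show ?case by (auto simp: trop_one_def intro!: exI[of _ "[i]"] split: if_splits)
next
  case (Suc k)
  obtain l where l: "trop_product A (Suc k) $ i $ j = trop_product A k $ i $ l + A (Suc k) $ l $ j"
    using trop_mult_attained[of "trop_product A k" "A (Suc k)" i j] by auto
  then have "trop_product A k $ i $ l \<noteq> -\<infinity>" using Suc.prems by auto
  then obtain xs where xs: "length xs = Suc k" "hd xs = i" "last xs = l"
    "level_weight A 0 xs = trop_product A k $ i $ l" using Suc by fastforce
  obtain ys where ys: "xs = ys @ [l]" using xs by (cases xs rule: rev_cases) auto
  have "level_weight A 0 (xs @ [j]) = level_weight A 0 xs + A (Suc k) $ l $ j"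
    using level_weight_append[of A 0 ys l "[j]"] xs(1) ys by simp
  moreover have "xs \<noteq> []" using xs by auto
  ultimately show ?case using xs l by (intro exI[of _ "xs @ [j]"]) auto
qed

section \<open>Walks on the trellis\<close>

fun level_walk :: "nat \<Rightarrow> 'a list \<Rightarrow> ('a \<times> nat) list" where
  "level_walk s [] = []"
| "level_walk s (x # xs) = (x, s) # level_walk (Suc s) xs"

lemma level_walk_simps [simp]:
  "length (level_walk s xs) = length xs" "map fst (level_walk s xs) = xs"
  "level_walk s xs = [] \<longleftrightarrow> xs = []"
  by (induction xs arbitrary: s) auto

lemma hd_level_walk [simp]: "xs \<noteq> [] \<Longrightarrow> hd (level_walk s xs) = (hd xs, s)"
  by (cases xs) auto

lemma last_level_walk [simp]: "xs \<noteq> [] \<Longrightarrow> last (level_walk s xs) = (last xs, s + length xs - 1)"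
  by (induction xs arbitrary: s) auto

lemma fst_butlast_tl_level_walk:
  "fst ` set (butlast (level_walk s xs)) = set (butlast xs)"
  "fst ` set (tl (level_walk s xs)) = set (tl xs)"
  by (simp_all flip: set_map add: map_butlast map_tl)

lemma vwalk_level_walk:
  assumes "xs \<noteq> []" "set (vwalk_arcs xs) \<subseteq> parcs D" "s + length xs \<le> Suc k"
  shows "vwalk (level_walk s xs) (with_proj (trellis D k))"
  using assms
proof (induction xs arbitrary: s rule: vwalk_arcs.induct)
  case (3 x y xs)
  have "vwalk (level_walk (Suc s) (y # xs)) (with_proj (trellis D k))" by (rule 3(1)) (use 3 in auto)
  moreover have "((x, Suc s - 1), (y, Suc s)) \<in> parcs (trellis D k)" "(x, s) \<in> pverts (trellis D k)"
    using 3(3,4) unfolding trellis_def by force+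
  ultimately show ?case by (simp add: vwalk_def)
qed (auto simp: vwalk_def trellis_def)

lemma vwalk_weight_level_walk:
  "vwalk_weight (trellis_weight A) (level_walk s xs) = level_weight A s xs"
  by (induction A s xs rule: level_weight.induct) (auto simp: vwalk_weight_def trellis_weight_def)

text \<open>Each trellis arc raises the level by exactly one, so a trellis walk carries no more
  information than its first level and its node list. All later arguments use plain node
  lists.\<close>

lemma vwalk_trellis_level_walk:
  assumes "vwalk p (with_proj (trellis D k))"
  shows "p = level_walk (snd (hd p)) (map fst p) \<and> set (vwalk_arcs (map fst p)) \<subseteq> parcs D
    \<and> snd (hd p) + length p \<le> Suc k"
  using assms
proof (induction p rule: vwalk_arcs.induct)
  case (3 a b p)
  then have ab: "(a, b) \<in> parcs (trellis D k)" and "vwalk (b # p) (with_proj (trellis D k))"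
    by (auto simp: vwalk_def)
  then have IH: "b # p = level_walk (snd b) (map fst (b # p)) \<and> set (vwalk_arcs (map fst (b # p))) \<subseteq> parcs D
    \<and> snd b + length (b # p) \<le> Suc k" using 3(1) by (simp only: list.sel)
  from ab obtain i j m where "a = (i, m - 1)" "b = (j, m)" "(i, j) \<in> parcs D" "1 \<le> m"
    by (auto simp: trellis_def)
  then obtain l where v: "a = (i, l)" "b = (j, Suc l)" "(i, j) \<in> parcs D" by (cases m) auto
  have "a # b # p = level_walk (snd a) (map fst (a # b # p))"
    using conjunct1[OF IH] unfolding v list.map fst_conv snd_conv level_walk.simps
    by (rule arg_cong)
  moreover have "set (vwalk_arcs (map fst (a # b # p))) \<subseteq> parcs D"
    using conjunct1[OF conjunct2[OF IH]] v by simp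
  moreover have "snd a + length (a # b # p) \<le> Suc k"
    using conjunct2[OF conjunct2[OF IH]] v by simp
  ultimately show ?case by (simp only: list.sel)
qed (auto simp: vwalk_def trellis_def)

text \<open>Levels bound the length of a walk. Finiteness turns the suprema over trellis walks into
  attained maxima.\<close>

lemma finite_trellis_walks: "finite {p. vwalk p (with_proj (trellis D k))}"
  for D :: "'n::finite pair_pre_digraph"
proof (rule finite_subset)
  show "{p. vwalk p (with_proj (trellis D k))} \<subseteq>
    {p. set p \<subseteq> UNIV \<times> {0..k} \<and> length p \<le> Suc k}"
  proof
    fix p assume "p \<in> {p. vwalk p (with_proj (trellis D k))}"
    then show "p \<in> {p. set p \<subseteq> UNIV \<times> {0..k} \<and> length p \<le> Suc k}"
      using conjunct2[OF vwalk_trellis_level_walk[of p D k]] by (auto simp: vwalk_def trellis_def)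
  qed
qed (rule finite_lists_length_le, simp)

lemma opt_to_crit_ge:
  assumes "xs \<noteq> []" "set (vwalk_arcs xs) \<subseteq> parcs D" "length xs \<le> Suc k"
    and "last xs \<in> Nc" "set (butlast xs) \<inter> Nc = {}"
  shows "level_weight A 0 xs \<le> opt_to_crit D Nc A k (hd xs)"
  unfolding opt_to_crit_def
proof (rule Sup_upper, intro CollectI exI conjI)
  show "level_weight A 0 xs = vwalk_weight (trellis_weight A) (level_walk 0 xs)"
    by (simp add: vwalk_weight_level_walk)
  show "vwalk (level_walk 0 xs) (with_proj (trellis D k))" using assms by (intro vwalk_level_walk) auto
  show "\<forall>x\<in>set (butlast (level_walk 0 xs)). fst x \<notin> Nc"
    using assms(5) fst_butlast_tl_level_walk[of 0 xs] by blast
qed (use assms in auto)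

lemma opt_to_crit_attained:
  fixes D :: "'n::finite pair_pre_digraph"
  assumes "opt_to_crit D Nc A k i \<noteq> -\<infinity>"
  obtains xs where "xs \<noteq> []" "set (vwalk_arcs xs) \<subseteq> parcs D" "length xs \<le> Suc k"
    "last xs \<in> Nc" "set (butlast xs) \<inter> Nc = {}" "hd xs = i"
    "level_weight A 0 xs = opt_to_crit D Nc A k i"
proof -
  let ?P = "\<lambda>p. vwalk p (with_proj (trellis D k)) \<and> hd p = (i, 0) \<and> fst (last p) \<in> Nc \<and>
            (\<forall>x\<in>set (butlast p). fst x \<notin> Nc)"
  let ?S = "{vwalk_weight (trellis_weight A) p | p. ?P p}"
  have "finite {p. ?P p}" by (rule finite_subset[OF _ finite_trellis_walks[of D k]]) auto
  then have "finite ?S" by (simp add: Setcompr_eq_image)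
  moreover have "?S \<noteq> {}"
  proof
    assume "?S = {}"
    then have "opt_to_crit D Nc A k i = Sup {}" unfolding opt_to_crit_def by (rule arg_cong)
    then show False using assms by (simp add: bot_ereal_def)
  qed
  ultimately have "opt_to_crit D Nc A k i \<in> ?S" unfolding opt_to_crit_def by (rule Sup_finite_in)
  then obtain p where p: "?P p" "opt_to_crit D Nc A k i = vwalk_weight (trellis_weight A) p"
    by auto
  define xs where "xs = map fst p"
  have s: "snd (hd p) = 0" using p(1) by simp
  have xs: "p = level_walk 0 xs \<and> set (vwalk_arcs xs) \<subseteq> parcs D \<and> 0 + length p \<le> Suc k"
    using vwalk_trellis_level_walk[OF conjunct1[OF p(1)]] unfolding s xs_def[symmetric] .
  then have "p = level_walk 0 xs" "set (vwalk_arcs xs) \<subseteq> parcs D" "length xs \<le> Suc k" "xs \<noteq> []"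
    using p(1) by (auto simp: vwalk_def)
  moreover from this p(1) have "\<forall>x\<in>set (butlast (level_walk 0 xs)). fst x \<notin> Nc"
    by simp
  then have "set (butlast xs) \<inter> Nc = {}"
    unfolding fst_butlast_tl_level_walk(1)[of 0 xs, symmetric] by auto
  ultimately show ?thesis using that[of xs] p by (auto simp: vwalk_weight_level_walk)
qed

lemma opt_from_crit_ge:
  assumes "xs \<noteq> []" "set (vwalk_arcs xs) \<subseteq> parcs D" "s + length xs = Suc k"
    and "hd xs \<in> Nc" "set (tl xs) \<inter> Nc = {}"
  shows "level_weight A s xs \<le> opt_from_crit D Nc A k (last xs)"
  unfolding opt_from_crit_def
proof (rule Sup_upper, intro CollectI exI conjI)
  show "level_weight A s xs = vwalk_weight (trellis_weight A) (level_walk s xs)"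
    by (simp add: vwalk_weight_level_walk)
  show "vwalk (level_walk s xs) (with_proj (trellis D k))" using assms by (intro vwalk_level_walk) auto
  show "\<forall>x\<in>set (tl (level_walk s xs)). fst x \<notin> Nc"
    using assms(5) fst_butlast_tl_level_walk[of s xs] by blast
qed (use assms in auto)

lemma opt_from_crit_attained:
  fixes D :: "'n::finite pair_pre_digraph"
  assumes "opt_from_crit D Nc A k j \<noteq> -\<infinity>"
  obtains xs s where "xs \<noteq> []" "set (vwalk_arcs xs) \<subseteq> parcs D" "s + length xs = Suc k"
    "hd xs \<in> Nc" "set (tl xs) \<inter> Nc = {}" "last xs = j"
    "level_weight A s xs = opt_from_crit D Nc A k j"
proof -
  let ?P = "\<lambda>p. vwalk p (with_proj (trellis D k)) \<and> fst (hd p) \<in> Nc \<and> last p = (j, k) \<and>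
            (\<forall>x\<in>set (tl p). fst x \<notin> Nc)"
  let ?S = "{vwalk_weight (trellis_weight A) p | p. ?P p}"
  have "finite {p. ?P p}" by (rule finite_subset[OF _ finite_trellis_walks[of D k]]) auto
  then have "finite ?S" by (simp add: Setcompr_eq_image)
  moreover have "?S \<noteq> {}"
  proof
    assume "?S = {}"
    then have "opt_from_crit D Nc A k j = Sup {}" unfolding opt_from_crit_def by (rule arg_cong)
    then show False using assms by (simp add: bot_ereal_def)
  qed
  ultimately have "opt_from_crit D Nc A k j \<in> ?S" unfolding opt_from_crit_def by (rule Sup_finite_in)
  then obtain p where p: "?P p" "opt_from_crit D Nc A k j = vwalk_weight (trellis_weight A) p"
    by auto
  define xs s where "xs = map fst p" and "s = snd (hd p)"
  have "p = level_walk s xs \<and> set (vwalk_arcs xs) \<subseteq> parcs D \<and> s + length p \<le> Suc k"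
    using vwalk_trellis_level_walk[OF conjunct1[OF p(1)]] unfolding s_def[symmetric] xs_def[symmetric] .
  then have xs: "p = level_walk s xs" "set (vwalk_arcs xs) \<subseteq> parcs D" "s + length xs \<le> Suc k" "xs \<noteq> []"
    using p(1) by (auto simp: vwalk_def)
  moreover from this p(1) have "\<forall>x\<in>set (tl (level_walk s xs)). fst x \<notin> Nc"
    by simp
  then have "set (tl xs) \<inter> Nc = {}"
    unfolding fst_butlast_tl_level_walk(2)[of s xs, symmetric] by auto
  moreover have "last xs = j \<and> s + length xs - 1 = k" using p(1) xs by auto
  ultimately show ?thesis using that[of xs s] p xs(4)
    by (auto simp: vwalk_weight_level_walk Suc_diff_le)
qed

section \<open>Cutting cycles out of walks\<close>

lemma vwalk_weight_append:
  "vwalk_weight w (xs @ x # ys) = vwalk_weight w (xs @ [x]) + vwalk_weight w (x # ys)"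
  by (induction xs rule: vwalk_arcs.induct) (auto simp: vwalk_weight_def add.assoc neq_Nil_conv)

lemma vwalk_arcs_append_mid:
  "set (vwalk_arcs (xs @ x # ys)) = set (vwalk_arcs (xs @ [x])) \<union> set (vwalk_arcs (x # ys))"
  by (induction xs rule: vwalk_arcs.induct) auto

lemma vwalk_arcs_cut:
  "set (vwalk_arcs (xs @ y # c @ y # r)) =
    set (vwalk_arcs (xs @ y # r)) \<union> set (vwalk_arcs (y # c @ [y]))"
  using vwalk_arcs_append_mid[of "y # c" y r]
  unfolding vwalk_arcs_append_mid[of xs y "c @ y # r"] vwalk_arcs_append_mid[of xs y r] append_Cons
  by (metis Un_assoc Un_commute)

lemma vwalk_weight_cut:
  "vwalk_weight w (xs @ y # c @ y # r) = vwalk_weight w (xs @ y # r) + vwalk_weight w (y # c @ [y])"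
  using vwalk_weight_append[of w "y # c" y r]
  unfolding vwalk_weight_append[of w xs y "c @ y # r"] vwalk_weight_append[of w xs y r] append_Cons
  by (metis add.assoc add.commute)

lemma closed_vwalk_mat_digraph:
  "closed_vwalk p (mat_digraph M) \<longleftrightarrow>
    p \<noteq> [] \<and> set (vwalk_arcs p) \<subseteq> parcs (mat_digraph M) \<and> hd p = last p \<and> 1 \<le> length p - 1"
  by (auto simp: closed_vwalk_def vwalk_def mat_digraph_def)

lemma vwalk_mean_le_iff:
  assumes "1 \<le> vwalk_length p"
  shows "vwalk_mean w p \<le> x \<longleftrightarrow> vwalk_weight w p \<le> ereal (real (vwalk_length p)) * x"
  unfolding vwalk_mean_def using assms by (intro ereal_divide_le_pos) auto

text \<open>The piece between two visits to a node is a cycle, which weighs at most its length times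
  the maximum cycle mean; \<open>d\<close> counts the steps removed in this way.\<close>

lemma vwalk_reduce:
  assumes "xs \<noteq> []" "set (vwalk_arcs xs) \<subseteq> parcs (mat_digraph M)"
  shows "\<exists>ys d. ys \<noteq> [] \<and> distinct ys \<and> set (vwalk_arcs ys) \<subseteq> parcs (mat_digraph M) \<and>
    hd ys = hd xs \<and> last ys = last xs \<and> set ys \<subseteq> set xs \<and> length xs = length ys + d \<and>
    vwalk_weight (mat_weight M) xs \<le>
      vwalk_weight (mat_weight M) ys + ereal (real d) * max_cycle_mean M"
  using assms
proof (induction "length xs" arbitrary: xs rule: less_induct)
  case less
  let ?w = "vwalk_weight (mat_weight M)" and ?E = "parcs (mat_digraph M)"
  show ?case
  proof (cases "distinct xs")
    case True
    \<comment> \<open>With \<open>d = 0\<close> the product is \<open>0\<close> even if there are no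
      cycles and the mean is \<open>-\<infinity>\<close>.\<close>
    then show ?thesis using less.prems by (intro exI[of _ xs] exI[of _ 0]) (simp flip: zero_ereal_def)
  next
    case False
    then obtain p y c r where xs: "xs = p @ [y] @ c @ [y] @ r" using not_distinct_decomp by blast
    define z cyc where "z = p @ y # r" and "cyc = y # c @ [y]"
    have arcs: "set (vwalk_arcs z) \<subseteq> ?E" "set (vwalk_arcs cyc) \<subseteq> ?E"
      using less.prems(2) vwalk_arcs_cut[of p y c r] by (simp_all only: xs z_def cyc_def append_Cons append_Nil Un_subset_iff)
    have wxs: "?w xs = ?w z + ?w cyc"
      using vwalk_weight_cut[of "mat_weight M" p y c r] by (simp only: xs z_def cyc_def append_Cons append_Nil)
    have "closed_vwalk cyc (mat_digraph M)" using arcs(2) by (simp add: closed_vwalk_mat_digraph cyc_def)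
    then have "vwalk_mean (mat_weight M) cyc \<le> max_cycle_mean M"
      unfolding max_cycle_mean_def by (auto intro: Sup_upper)
    then have cyc: "?w cyc \<le> ereal (real (Suc (length c))) * max_cycle_mean M"
      by (subst (asm) vwalk_mean_le_iff) (auto simp: cyc_def)
    obtain ys d where ys: "ys \<noteq> []" "distinct ys" "set (vwalk_arcs ys) \<subseteq> ?E" "hd ys = hd z"
      "last ys = last z" "set ys \<subseteq> set z" "length z = length ys + d"
      "?w z \<le> ?w ys + ereal (real d) * max_cycle_mean M"
      using less.hyps[of z] arcs(1) by (auto simp: xs z_def)
    have "?w xs \<le> ?w ys + ereal (real d) * max_cycle_mean M + ereal (real (Suc (length c))) * max_cycle_mean M"
      unfolding wxs using ys(8) cyc by (rule add_mono)
    also have "\<dots> = ?w ys + (ereal (real d) + ereal (real (Suc (length c)))) * max_cycle_mean M"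
      by (subst ereal_left_distrib) (auto simp: add.assoc)
    also have "ereal (real d) + ereal (real (Suc (length c))) = ereal (real (d + Suc (length c)))"
      by simp
    finally show ?thesis using ys(1-7)
      by (intro exI[of _ ys] exI[of _ "d + Suc (length c)"] conjI)
        (auto simp: xs z_def hd_append)
  qed
qed

text \<open>
  The maximum cycle mean is a supremum over infinitely many closed walks; the strict inequality survives
  because closed walks of length at most \<open>CARD('n)\<close> already determine it.
\<close>

lemma max_cycle_mean_neg:
  fixes M :: "'n::finite trop_mat"
  assumes neg: "\<And>p. closed_vwalk p (mat_digraph M) \<Longrightarrow> vwalk_weight (mat_weight M) p < 0"
  shows "max_cycle_mean M < 0"
proof -
  let ?w = "vwalk_weight (mat_weight M)"
  \<comment> \<open>The extra element \<open>-1\<close> keeps \<open>S\<close> nonempty, and its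
    maximum negative, when there are no closed walks.\<close>
  define S where "S = insert (-1) (vwalk_mean (mat_weight M) `
    {p. closed_vwalk p (mat_digraph M) \<and> length p \<le> Suc CARD('n)})"
  have "finite {p. set p \<subseteq> (UNIV :: 'n set) \<and> length p \<le> Suc CARD('n)}"
    by (rule finite_lists_length_le) simp
  then have finS: "finite S" unfolding S_def
    by (intro finite.insertI finite_imageI) (rule finite_subset[rotated], auto)
  define m where "m = Max S"
  have "x < 0" if x: "x \<in> S" for x
  proof (cases "x = -1")
    case True
    then show ?thesis by simp
  next
    case False
    then obtain p where p: "closed_vwalk p (mat_digraph M)" "x = vwalk_mean (mat_weight M) p"
      using x by (auto simp: S_def)
    then have "0 < real (vwalk_length p)" by (auto simp: closed_vwalk_def)
    then show ?thesis using neg[OF p(1)] unfolding p(2) vwalk_mean_def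
      by (cases "?w p") (auto simp: divide_neg_pos)
  qed
  then have m: "m < 0" unfolding m_def using finS by (subst Max_less_iff) (auto simp: S_def)
  have bound: "?w p \<le> ereal (real (vwalk_length p)) * m" if "closed_vwalk p (mat_digraph M)" for p
    using that
  proof (induction "length p" arbitrary: p rule: less_induct)
    case less
    have len: "1 \<le> vwalk_length p" using less.prems by (simp add: closed_vwalk_def)
    show ?case
    proof (cases "length p \<le> Suc CARD('n)")
      case True
      then have "vwalk_mean (mat_weight M) p \<le> m"
        unfolding m_def using finS less.prems by (intro Max_ge) (auto simp: S_def)
      then show ?thesis using vwalk_mean_le_iff[OF len] by blast
    next
      case False
      \<comment> \<open>\<open>length p\<close> counts the end node twice; without it more than
        \<open>CARD('n)\<close> nodes remain. The repetition splits \<open>p\<close> into two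
        shorter closed walks, whose bounds add up.\<close>
      have "\<not> distinct (butlast p)"
      proof
        assume "distinct (butlast p)"
        then have "length (butlast p) = card (set (butlast p))" by (simp add: distinct_card)
        also have "\<dots> \<le> CARD('n)" by (rule card_mono) auto
        finally show False using False by simp
      qed
      then obtain a y c r where b: "butlast p = a @ [y] @ c @ [y] @ r" using not_distinct_decomp by blast
      define t where "t = r @ [last p]"
      have "p = butlast p @ [last p]" using len by (metis append_butlast_last_id list.size(3) vwalk_length_simp diff_is_0_eq not_one_le_zero zero_le)
      then have p: "p = a @ y # c @ y # t" by (simp add: b t_def)
      define z cyc where "z = a @ y # t" and "cyc = y # c @ [y]"
      have arcs: "set (vwalk_arcs z) \<subseteq> parcs (mat_digraph M)" "set (vwalk_arcs cyc) \<subseteq> parcs (mat_digraph M)"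
        using less.prems vwalk_arcs_cut[of a y c t]
        by (simp_all only: p z_def cyc_def closed_vwalk_mat_digraph) blast+
      have "t \<noteq> []" by (simp add: t_def)
      then have "hd z = last z" using less.prems by (auto simp: closed_vwalk_def p z_def hd_append)
      then have "closed_vwalk z (mat_digraph M)" "closed_vwalk cyc (mat_digraph M)"
        using arcs \<open>t \<noteq> []\<close> by (auto simp: closed_vwalk_mat_digraph cyc_def z_def Suc_le_eq)
      then have b: "?w z \<le> ereal (real (vwalk_length z)) * m" "?w cyc \<le> ereal (real (vwalk_length cyc)) * m"
        using less.hyps[of z] less.hyps[of cyc] \<open>t \<noteq> []\<close> by (auto simp: p z_def cyc_def)
      have "?w p = ?w z + ?w cyc"
        using vwalk_weight_cut[of "mat_weight M" a y c t] by (simp only: p z_def cyc_def)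
      also have "\<dots> \<le> ereal (real (vwalk_length z)) * m + ereal (real (vwalk_length cyc)) * m"
        using b by (rule add_mono)
      also have "\<dots> = (ereal (real (vwalk_length z)) + ereal (real (vwalk_length cyc))) * m"
        by (subst ereal_left_distrib) auto
      also have "ereal (real (vwalk_length z)) + ereal (real (vwalk_length cyc)) = ereal (real (vwalk_length p))"
        using \<open>t \<noteq> []\<close> by (auto simp: p z_def cyc_def)
      finally show ?thesis .
    qed
  qed
  have "max_cycle_mean M \<le> m" unfolding max_cycle_mean_def
  proof (rule Sup_least)
    fix x assume "x \<in> {vwalk_mean (mat_weight M) p |p. closed_vwalk p (mat_digraph M)}"
    then obtain p where p: "closed_vwalk p (mat_digraph M)" "x = vwalk_mean (mat_weight M) p" by auto
    then show "x \<le> m" using bound[OF p(1)] vwalk_mean_le_iff[of p "mat_weight M" m]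
      by (simp add: closed_vwalk_def)
  qed
  then show ?thesis using m by simp
qed

section \<open>Reduction of walks to paths\<close>

lemma trop_power_crit_mat:
  "trop_power (crit_mat G) l $ a $ b = (if (a, b) \<in> parcs G ^^ l then 0 else -\<infinity>)"
proof (induction l arbitrary: b)
  case 0
  then show ?case by (simp add: trop_one_def)
next
  case (Suc l)
  let ?P = "trop_power (crit_mat G) l" and ?S = "crit_mat G"
  have S: "?S $ x $ y = (if (x, y) \<in> parcs G then 0 else -\<infinity>)" for x y
    by (simp add: crit_mat_def)
  obtain m where m: "(?P \<otimes>\<^sub>t ?S) $ a $ b = ?P $ a $ m + ?S $ m $ b"
    by (rule trop_mult_attained)
  show ?case
  proof (cases "(a, b) \<in> parcs G ^^ Suc l")
    case True
    then obtain x where "(a, x) \<in> parcs G ^^ l" "(x, b) \<in> parcs G" by auto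
    then have "0 \<le> (?P \<otimes>\<^sub>t ?S) $ a $ b"
      using trop_mult_ge[of ?P a x ?S b] Suc by (simp add: S)
    then show ?thesis using m True Suc by (auto simp: S split: if_splits)
  next
    case False
    then show ?thesis using m Suc by (auto simp: S)
  qed
qed

lemma level_weight_glue:
  assumes "xs \<noteq> []" "zs \<noteq> []" "last xs = hd zs"
  shows "level_weight A s (xs @ tl zs) = level_weight A s xs + level_weight A (s + length xs - 1) zs"
proof -
  obtain ys x where xs: "xs = ys @ [x]" using assms(1) by (cases xs rule: rev_cases) auto
  obtain us where "zs = x # us" using assms(2,3) xs by (cases zs) auto
  then show ?thesis using level_weight_append[of A s ys x us] xs by simp
qed

lemma vwalk_weight_le_0:
  assumes "\<And>x y. M $ x $ y \<le> 0"
  shows "vwalk_weight (mat_weight M) xs \<le> 0"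
  using assms by (induction xs rule: vwalk_arcs.induct)
    (auto simp: vwalk_weight_def mat_weight_def intro!: add_nonpos_nonpos)

lemma vwalk_weight_finite:
  assumes "\<And>x y. M $ x $ y \<le> 0" "set (vwalk_arcs xs) \<subseteq> parcs (mat_digraph M)"
  shows "vwalk_weight (mat_weight M) xs \<noteq> -\<infinity>"
  using assms(2)
proof (induction xs rule: vwalk_arcs.induct)
  case (3 x y xs)
  then show ?case using assms(1)[of x y] vwalk_weight_le_0[OF assms(1), of "y # xs"]
    by (auto simp: vwalk_weight_def mat_weight_def mat_digraph_def)
qed (auto simp: vwalk_weight_def)

lemma path_avoiding_le_0:
  assumes "\<And>x y. M $ x $ y \<le> 0"
  shows "path_avoiding M Nc i j \<le> 0"
  unfolding path_avoiding_def
  using vwalk_weight_le_0[OF assms] by (auto intro!: Sup_least)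

lemma path_to_crit_le_0:
  assumes "\<And>x y. M $ x $ y \<le> 0"
  shows "path_to_crit M Nc i \<le> 0"
  unfolding path_to_crit_def
  using vwalk_weight_le_0[OF assms] by (auto intro!: Sup_least)

lemma path_from_crit_le_0:
  assumes "\<And>x y. M $ x $ y \<le> 0"
  shows "path_from_crit M Nc j \<le> 0"
  unfolding path_from_crit_def
  using vwalk_weight_le_0[OF assms] by (auto intro!: Sup_least)

lemma vwalk_mat_digraph:
  "vwalk p (with_proj (mat_digraph M)) \<longleftrightarrow> p \<noteq> [] \<and> set (vwalk_arcs p) \<subseteq> parcs (mat_digraph M)"
  by (auto simp: vwalk_def mat_digraph_def)

lemma noncrit_mat_avoiding:
  assumes "set xs \<inter> Nc = {}"
  shows "vwalk_weight (mat_weight (noncrit_mat M Nc)) xs = vwalk_weight (mat_weight M) xs"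
    and "set (vwalk_arcs xs) \<subseteq> parcs (mat_digraph (noncrit_mat M Nc)) \<longleftrightarrow>
      set (vwalk_arcs xs) \<subseteq> parcs (mat_digraph M)"
  using assms by (induction xs rule: vwalk_arcs.induct)
    (auto simp: vwalk_weight_def mat_weight_def mat_digraph_def noncrit_mat_def)

text \<open>A walk avoiding \<open>Nc\<close> has the same arcs and weights under
  \<open>noncrit_mat M Nc\<close>, so each removed step is charged with the mean of that matrix. The
  path that remains has only noncritical nodes.\<close>

lemma avoiding_walk_reduce:
  fixes M :: "'n::finite trop_mat"
  assumes "xs \<noteq> []" "set (vwalk_arcs xs) \<subseteq> parcs (mat_digraph M)" "set xs \<inter> Nc = {}"
  obtains ys d where "ys \<noteq> []" "distinct ys" "set (vwalk_arcs ys) \<subseteq> parcs (mat_digraph M)"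
    "set ys \<inter> Nc = {}" "hd ys = hd xs" "last ys = last xs" "length xs = length ys + d"
    "length ys \<le> CARD('n) - card Nc"
    "vwalk_weight (mat_weight M) xs \<le>
      vwalk_weight (mat_weight M) ys + ereal (real d) * max_cycle_mean (noncrit_mat M Nc)"
proof -
  let ?B = "noncrit_mat M Nc"
  have "set (vwalk_arcs xs) \<subseteq> parcs (mat_digraph ?B)"
    using noncrit_mat_avoiding(2)[OF assms(3), of M] assms(2) by blast
  from vwalk_reduce[OF assms(1) this] obtain ys d where ys: "ys \<noteq> []" "distinct ys"
    "set (vwalk_arcs ys) \<subseteq> parcs (mat_digraph ?B)" "hd ys = hd xs" "last ys = last xs"
    "set ys \<subseteq> set xs" "length xs = length ys + d"
    "vwalk_weight (mat_weight ?B) xs \<le>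
      vwalk_weight (mat_weight ?B) ys + ereal (real d) * max_cycle_mean ?B"
    by blast
  have a: "set ys \<inter> Nc = {}" using ys(6) assms(3) by auto
  then have "set ys \<subseteq> - Nc" by auto
  then have "card (set ys) \<le> card (- Nc)" by (intro card_mono) auto
  then have "length ys \<le> CARD('n) - card Nc"
    using ys(2) by (simp add: distinct_card Compl_eq_Diff_UNIV card_Diff_subset)
  then show ?thesis
    using that[of ys d] ys a noncrit_mat_avoiding[OF assms(3), of M] noncrit_mat_avoiding[OF a, of M]
    by auto
qed

text \<open>Only the part before the last node is reduced, since it avoids \<open>Nc\<close>. The
  critical end node is then put back, which preserves distinctness and accounts for the
  \<open>Suc\<close>.\<close>

lemma to_crit_reduce:
  fixes M :: "'n::finite trop_mat"
  assumes "xs \<noteq> []" "set (vwalk_arcs xs) \<subseteq> parcs (mat_digraph M)" "last xs \<in> Nc"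
    "set (butlast xs) \<inter> Nc = {}"
  obtains d where "length xs \<le> Suc (CARD('n) - card Nc) + d"
    "vwalk_weight (mat_weight M) xs \<le>
      path_to_crit M Nc (hd xs) + ereal (real d) * max_cycle_mean (noncrit_mat M Nc)"
proof (cases "butlast xs")
  case Nil
  then obtain a where a: "xs = [a]" using assms(1) by (cases xs rule: rev_cases) auto
  have "vwalk_weight (mat_weight M) [a] \<le> path_to_crit M Nc a"
    unfolding path_to_crit_def using assms(3) a
    by (intro Sup_upper) (auto simp: vpath_def vwalk_mat_digraph intro!: exI[of _ "[a]"])
  then show ?thesis using that[of 0] a by (simp flip: zero_ereal_def)
next
  case Cons
  define zs a where "zs = butlast xs" and "a = last xs"
  have xs: "xs = zs @ [a]" unfolding zs_def a_def by (rule append_butlast_last_id[OF assms(1), symmetric])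
  have zs: "zs \<noteq> []" using Cons by (simp add: zs_def)
  have arcs: "set (vwalk_arcs zs) \<subseteq> parcs (mat_digraph M)" "(last zs, a) \<in> parcs (mat_digraph M)"
    using assms(2) xs zs by (auto simp: vwalk_arcs_append)
  have "set zs \<inter> Nc = {}" using assms(4) zs_def by simp
  from avoiding_walk_reduce[OF zs arcs(1) this]
  obtain ys d where ys: "ys \<noteq> []" "distinct ys" "set (vwalk_arcs ys) \<subseteq> parcs (mat_digraph M)"
    "set ys \<inter> Nc = {}" "hd ys = hd zs" "last ys = last zs" "length zs = length ys + d"
    "length ys \<le> CARD('n) - card Nc"
    "vwalk_weight (mat_weight M) zs \<le>
      vwalk_weight (mat_weight M) ys + ereal (real d) * max_cycle_mean (noncrit_mat M Nc)"
    by metis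
  have w: "vwalk_weight (mat_weight M) (us @ [a]) = vwalk_weight (mat_weight M) us + M $ last us $ a"
    if "us \<noteq> []" for us
    using that by (simp add: vwalk_weight_def vwalk_arcs_append mat_weight_def)
  have "vpath (ys @ [a]) (with_proj (mat_digraph M))"
    using ys arcs(2) assms(3) by (auto simp: vpath_def vwalk_mat_digraph vwalk_arcs_append a_def)
  then have "vwalk_weight (mat_weight M) (ys @ [a]) \<le> path_to_crit M Nc (hd xs)"
    unfolding path_to_crit_def
  proof (intro Sup_upper CollectI exI conjI)
    show "hd (ys @ [a]) = hd xs" using ys(1,5) zs unfolding xs by simp
    show "last (ys @ [a]) \<in> Nc" using assms(3) by (simp add: a_def)
  qed auto
  then have le: "vwalk_weight (mat_weight M) ys + M $ last zs $ a \<le> path_to_crit M Nc (hd xs)"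
    using w[OF ys(1)] ys(6) by simp
  have "vwalk_weight (mat_weight M) xs \<le>
      vwalk_weight (mat_weight M) ys + ereal (real d) * max_cycle_mean (noncrit_mat M Nc) + M $ last zs $ a"
    unfolding xs w[OF zs] using ys(9) by (rule add_right_mono)
  also have "\<dots> = vwalk_weight (mat_weight M) ys + M $ last zs $ a
      + ereal (real d) * max_cycle_mean (noncrit_mat M Nc)" by (simp add: ac_simps)
  also have "\<dots> \<le> path_to_crit M Nc (hd xs) + ereal (real d) * max_cycle_mean (noncrit_mat M Nc)"
    using le by (rule add_right_mono)
  finally show ?thesis using that[of d] ys(7,8) xs by simp
qed

text \<open>Mirror image of \<open>to_crit_reduce\<close>: the critical node is detached from the
  front.\<close>

lemma from_crit_reduce:
  fixes M :: "'n::finite trop_mat"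
  assumes "xs \<noteq> []" "set (vwalk_arcs xs) \<subseteq> parcs (mat_digraph M)" "hd xs \<in> Nc"
    "set (tl xs) \<inter> Nc = {}"
  obtains d where "length xs \<le> Suc (CARD('n) - card Nc) + d"
    "vwalk_weight (mat_weight M) xs \<le>
      path_from_crit M Nc (last xs) + ereal (real d) * max_cycle_mean (noncrit_mat M Nc)"
proof (cases "tl xs")
  case Nil
  then obtain a where a: "xs = [a]" using assms(1) by (cases xs) auto
  have "vwalk_weight (mat_weight M) [a] \<le> path_from_crit M Nc a"
    unfolding path_from_crit_def using assms(3) a
    by (intro Sup_upper) (auto simp: vpath_def vwalk_mat_digraph intro!: exI[of _ "[a]"])
  then show ?thesis using that[of 0] a by (simp flip: zero_ereal_def)
next
  case Cons
  define zs a where "zs = tl xs" and "a = hd xs"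
  have xs: "xs = a # zs" unfolding zs_def a_def by (rule hd_Cons_tl[OF assms(1), symmetric])
  have zs: "zs \<noteq> []" using Cons by (simp add: zs_def)
  have arcs: "set (vwalk_arcs zs) \<subseteq> parcs (mat_digraph M)" "(a, hd zs) \<in> parcs (mat_digraph M)"
    using assms(2) xs zs by auto
  have "set zs \<inter> Nc = {}" using assms(4) zs_def by simp
  from avoiding_walk_reduce[OF zs arcs(1) this]
  obtain ys d where ys: "ys \<noteq> []" "distinct ys" "set (vwalk_arcs ys) \<subseteq> parcs (mat_digraph M)"
    "set ys \<inter> Nc = {}" "hd ys = hd zs" "last ys = last zs" "length zs = length ys + d"
    "length ys \<le> CARD('n) - card Nc"
    "vwalk_weight (mat_weight M) zs \<le>
      vwalk_weight (mat_weight M) ys + ereal (real d) * max_cycle_mean (noncrit_mat M Nc)"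
    by metis
  have w: "vwalk_weight (mat_weight M) (a # us) = M $ a $ hd us + vwalk_weight (mat_weight M) us"
    if "us \<noteq> []" for us
    using that by (simp add: vwalk_weight_def mat_weight_def)
  have "vpath (a # ys) (with_proj (mat_digraph M))"
    using ys arcs(2) assms(3) by (auto simp: vpath_def vwalk_mat_digraph a_def)
  then have "vwalk_weight (mat_weight M) (a # ys) \<le> path_from_crit M Nc (last xs)"
    unfolding path_from_crit_def
  proof (intro Sup_upper CollectI exI conjI)
    show "last (a # ys) = last xs" using ys(1,6) zs unfolding xs by simp
    show "hd (a # ys) \<in> Nc" using assms(3) by (simp add: a_def)
  qed auto
  then have le: "M $ a $ hd zs + vwalk_weight (mat_weight M) ys \<le> path_from_crit M Nc (last xs)"
    using w[OF ys(1)] ys(5) by simp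
  have "vwalk_weight (mat_weight M) xs \<le> M $ a $ hd zs +
      (vwalk_weight (mat_weight M) ys + ereal (real d) * max_cycle_mean (noncrit_mat M Nc))"
    unfolding xs w[OF zs] using ys(9) by (rule add_left_mono)
  also have "\<dots> = M $ a $ hd zs + vwalk_weight (mat_weight M) ys
      + ereal (real d) * max_cycle_mean (noncrit_mat M Nc)" by (simp add: ac_simps)
  also have "\<dots> \<le> path_from_crit M Nc (last xs) + ereal (real d) * max_cycle_mean (noncrit_mat M Nc)"
    using le by (rule add_right_mono)
  finally show ?thesis using that[of d] ys(7,8) xs by simp
qed

text \<open>The last conclusion certifies that the second part of the bound speaks about these end
  nodes.\<close>

lemma avoiding_reduce:
  fixes M :: "'n::finite trop_mat"
  assumes le0: "\<And>x y. M $ x $ y \<le> 0"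
    and "2 \<le> length xs" "set (vwalk_arcs xs) \<subseteq> parcs (mat_digraph M)" "set xs \<inter> Nc = {}"
  obtains d where "length xs \<le> Suc (CARD('n) - card Nc) + d"
    "vwalk_weight (mat_weight M) xs \<le>
      path_avoiding M Nc (hd xs) (last xs) + ereal (real d) * max_cycle_mean (noncrit_mat M Nc)"
    "path_avoiding M Nc (hd xs) (last xs) \<noteq> -\<infinity>"
proof (cases "hd xs = last xs")
  case False
  have "xs \<noteq> []" using assms(2) by auto
  from avoiding_walk_reduce[OF this assms(3,4)]
  obtain ys d where ys: "ys \<noteq> []" "distinct ys" "set (vwalk_arcs ys) \<subseteq> parcs (mat_digraph M)"
    "set ys \<inter> Nc = {}" "hd ys = hd xs" "last ys = last xs" "length xs = length ys + d"
    "length ys \<le> CARD('n) - card Nc"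
    "vwalk_weight (mat_weight M) xs \<le>
      vwalk_weight (mat_weight M) ys + ereal (real d) * max_cycle_mean (noncrit_mat M Nc)"
    by metis
  have le: "vwalk_weight (mat_weight M) ys \<le> path_avoiding M Nc (hd xs) (last xs)"
    unfolding path_avoiding_def using False ys
    by (auto simp: vpath_def vwalk_mat_digraph intro!: Sup_upper)
  have "vwalk_weight (mat_weight M) xs \<le>
      path_avoiding M Nc (hd xs) (last xs) + ereal (real d) * max_cycle_mean (noncrit_mat M Nc)"
    using ys(9) add_right_mono[OF le] by (rule order_trans)
  moreover have "path_avoiding M Nc (hd xs) (last xs) \<noteq> -\<infinity>"
    using le vwalk_weight_finite[OF le0 ys(3)] by auto
  ultimately show ?thesis using that[of d] ys(7,8) by simp
next
  case True
  \<comment> \<open>Reducing a closed walk as a whole would leave a single node, which is not a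
    cycle. So the first node is detached, the rest is reduced to a path ending in \<open>a\<close>,
    and \<open>a\<close> is put in front again.\<close>
  define zs a where "zs = tl xs" and "a = hd xs"
  have xs: "xs = a # zs" "zs \<noteq> []" using assms(2) by (cases xs; auto simp: zs_def a_def)+
  have arcs: "set (vwalk_arcs zs) \<subseteq> parcs (mat_digraph M)" "(a, hd zs) \<in> parcs (mat_digraph M)"
    using assms(3) xs by auto
  have "set zs \<inter> Nc = {}" using assms(4) xs by simp
  from avoiding_walk_reduce[OF xs(2) arcs(1) this]
  obtain ys d where ys: "ys \<noteq> []" "distinct ys" "set (vwalk_arcs ys) \<subseteq> parcs (mat_digraph M)"
    "set ys \<inter> Nc = {}" "hd ys = hd zs" "last ys = last zs" "length zs = length ys + d"
    "length ys \<le> CARD('n) - card Nc"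
    "vwalk_weight (mat_weight M) zs \<le>
      vwalk_weight (mat_weight M) ys + ereal (real d) * max_cycle_mean (noncrit_mat M Nc)"
    by metis
  have w: "vwalk_weight (mat_weight M) (a # us) = M $ a $ hd us + vwalk_weight (mat_weight M) us"
    if "us \<noteq> []" for us
    using that by (simp add: vwalk_weight_def mat_weight_def)
  have ayarcs: "set (vwalk_arcs (a # ys)) \<subseteq> parcs (mat_digraph M)" using ys arcs(2) by auto
  have "closed_vwalk (a # ys) (mat_digraph M)"
    using ayarcs ys True xs by (auto simp: closed_vwalk_mat_digraph Suc_le_eq)
  moreover have "set (a # ys) \<inter> Nc = {}" using ys(4) assms(4) xs(1) by auto
  ultimately have le: "vwalk_weight (mat_weight M) (a # ys) \<le> path_avoiding M Nc (hd xs) (last xs)"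
    unfolding path_avoiding_def using True xs(1)
    by (auto intro!: Sup_upper exI[of _ "a # ys"])
  have "vwalk_weight (mat_weight M) xs \<le> M $ a $ hd zs +
      (vwalk_weight (mat_weight M) ys + ereal (real d) * max_cycle_mean (noncrit_mat M Nc))"
    unfolding xs(1) w[OF xs(2)] using ys(9) by (rule add_left_mono)
  also have "\<dots> = vwalk_weight (mat_weight M) (a # ys)
      + ereal (real d) * max_cycle_mean (noncrit_mat M Nc)" by (simp add: ac_simps w[OF ys(1)] ys(5))
  also have "\<dots> \<le> path_avoiding M Nc (hd xs) (last xs) + ereal (real d) * max_cycle_mean (noncrit_mat M Nc)"
    using le by (rule add_right_mono)
  finally have 2: "vwalk_weight (mat_weight M) xs \<le>
    path_avoiding M Nc (hd xs) (last xs) + ereal (real d) * max_cycle_mean (noncrit_mat M Nc)" .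
  have 3: "path_avoiding M Nc (hd xs) (last xs) \<noteq> -\<infinity>"
    using le vwalk_weight_finite[OF le0 ayarcs] by auto
  have 1: "length xs \<le> Suc (CARD('n) - card Nc) + d" using ys(7,8) xs(1) by simp
  show ?thesis by (rule that[OF 1 2 3])
qed

section \<open>Entries of the CSR term\<close>

text \<open>A critical walk of the stated length splits into pieces of lengths \<open>m\<close>,
  \<open>r\<close> and \<open>m\<close>, one for each power of \<open>S\<close>, and each power
  contributes \<open>0\<close>.\<close>

lemma csr_ge:
  fixes G :: "'n::finite trop_mat"
  assumes g: "g = cyclicity Cr"
    and ab: "(a, b) \<in> parcs Cr ^^ (2 * ((t + 1) * g - k mod g) + k mod g)"
  shows "G $ i $ a + G $ b $ j \<le> csr Cr t k G $ i $ j"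
proof -
  define r m where "r = k mod g" and "m = (t + 1) * g - k mod g"
  define S P where "S = crit_mat Cr" and "P = trop_power S m"
  have "(a, b) \<in> parcs Cr ^^ (m + (r + m))"
    using ab unfolding r_def m_def by (simp only: mult_2 ac_simps)
  then obtain x y where xy: "(a, x) \<in> parcs Cr ^^ m" "(x, y) \<in> parcs Cr ^^ r" "(y, b) \<in> parcs Cr ^^ m"
    unfolding relpow_add by blast
  have "G $ i $ a \<le> (G \<otimes>\<^sub>t P) $ i $ x"
    using trop_mult_ge[of G i a P x] xy(1) by (simp add: P_def S_def trop_power_crit_mat)
  also have "\<dots> \<le> (G \<otimes>\<^sub>t P \<otimes>\<^sub>t trop_power S r) $ i $ y"
    using trop_mult_ge[of "G \<otimes>\<^sub>t P" i x "trop_power S r" y] xy(2) by (simp add: S_def trop_power_crit_mat)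
  finally have 1: "G $ i $ a \<le> (G \<otimes>\<^sub>t P \<otimes>\<^sub>t trop_power S r) $ i $ y" .
  have "G $ b $ j \<le> (P \<otimes>\<^sub>t G) $ y $ j"
    using trop_mult_ge[of P y b G j] xy(3) by (simp add: P_def S_def trop_power_crit_mat)
  with 1 have "G $ i $ a + G $ b $ j \<le>
      (G \<otimes>\<^sub>t P \<otimes>\<^sub>t trop_power S r) $ i $ y + (P \<otimes>\<^sub>t G) $ y $ j" by (rule add_mono)
  also have "\<dots> \<le> csr Cr t k G $ i $ j"
    unfolding csr_def Let_def using trop_mult_ge by (simp add: P_def S_def r_def m_def g)
  finally show ?thesis .
qed

text \<open>The optimal inner indices give three entries of powers of \<open>S\<close>. Without
  \<open>\<infinity>\<close> in \<open>G\<close> none of them can be \<open>-\<infinity>\<close>, so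
  they are \<open>0\<close> and the corresponding critical walks concatenate.\<close>

lemma csr_attained:
  fixes G :: "'n::finite trop_mat"
  assumes g: "g = cyclicity Cr" and fin: "\<And>x y. G $ x $ y \<noteq> \<infinity>" and ne: "csr Cr t k G $ i $ j \<noteq> -\<infinity>"
  obtains a b where "(a, b) \<in> parcs Cr ^^ (2 * ((t + 1) * g - k mod g) + k mod g)"
    "csr Cr t k G $ i $ j = G $ i $ a + G $ b $ j"
proof -
  define r m where "r = k mod g" and "m = (t + 1) * g - k mod g"
  define S P where "S = crit_mat Cr" and "P = trop_power S m"
  have csr: "csr Cr t k G = G \<otimes>\<^sub>t P \<otimes>\<^sub>t trop_power S r \<otimes>\<^sub>t (P \<otimes>\<^sub>t G)"
    by (simp add: csr_def Let_def P_def S_def r_def m_def g)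
  have S: "trop_power S l $ x $ y = (if (x, y) \<in> parcs Cr ^^ l then 0 else -\<infinity>)" for l x y
    by (simp add: S_def trop_power_crit_mat)
  obtain y where y: "csr Cr t k G $ i $ j = (G \<otimes>\<^sub>t P \<otimes>\<^sub>t trop_power S r) $ i $ y + (P \<otimes>\<^sub>t G) $ y $ j"
    unfolding csr by (rule trop_mult_attained)
  obtain x where x: "(G \<otimes>\<^sub>t P \<otimes>\<^sub>t trop_power S r) $ i $ y = (G \<otimes>\<^sub>t P) $ i $ x + trop_power S r $ x $ y"
    by (rule trop_mult_attained)
  obtain a where a: "(G \<otimes>\<^sub>t P) $ i $ x = G $ i $ a + P $ a $ x" by (rule trop_mult_attained)
  obtain b where b: "(P \<otimes>\<^sub>t G) $ y $ j = P $ y $ b + G $ b $ j" by (rule trop_mult_attained)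
  have eq: "csr Cr t k G $ i $ j = G $ i $ a + P $ a $ x + trop_power S r $ x $ y + (P $ y $ b + G $ b $ j)"
    using y x a b by simp
  have walks: "(a, x) \<in> parcs Cr ^^ m" "(x, y) \<in> parcs Cr ^^ r" "(y, b) \<in> parcs Cr ^^ m"
    using ne eq fin[of i a] fin[of b j] unfolding P_def S
    by (auto split: if_splits)
  have "(a, b) \<in> parcs Cr ^^ (m + r + m)"
    using relpow_trans[OF relpow_trans[OF walks(1,2)] walks(3)] .
  moreover have "m + r + m = 2 * ((t + 1) * g - k mod g) + k mod g" by (simp add: r_def m_def)
  ultimately have "(a, b) \<in> parcs Cr ^^ (2 * ((t + 1) * g - k mod g) + k mod g)" by simp
  moreover have "csr Cr t k G $ i $ j = G $ i $ a + G $ b $ j"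
    using eq walks unfolding P_def S by simp
  ultimately show ?thesis by (rule that)
qed

section \<open>Turning the quotient bounds into statements about removed steps\<close>

text \<open>Here \<open>x\<close> is the weight of optimal walks, \<open>a\<close> and
  \<open>b\<close> are path weights and \<open>d\<close> counts removed steps. Dividing the decay
  estimate by the negative \<open>lam\<close> gives \<open>d\<close> at most the quotient.\<close>

lemma quot_mean_le_imp:
  fixes N :: nat
  assumes "lam < 0" "x \<noteq> -\<infinity>" "a \<le> 0" "b \<le> 0"
    and x: "x \<le> a + b + ereal (real d) * lam"
    and k: "quot_mean (x - a - b) lam + ereal (real N) \<le> ereal (real k)"
  shows "d + N \<le> k"
proof (cases lam)
  case MInf
  \<comment> \<open>A single removed step would make the upper bound for \<open>x\<close> equal to
    \<open>-\<infinity>\<close>; this agrees with reading the quotient as \<open>0\<close>.\<close>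
  then have "d = 0" using x assms by (cases "d = 0"; cases a; cases b) auto
  then show ?thesis using k MInf by (simp add: quot_mean_def)
next
  case (real r)
  then have r: "r < 0" using assms by simp
  obtain a' where a: "a = ereal a'" using x assms real by (cases a; cases b) auto
  obtain b' where b: "b = ereal b'" using x assms real by (cases a; cases b) auto
  obtain x' where x': "x = ereal x'" using x assms real a b by (cases x) auto
  have "(x' - a' - b') / r + real N \<le> real k" using k real a b x' r by (simp add: quot_mean_def)
  moreover have "x' \<le> a' + b' + real d * r" using x real a b x' by simp
  then have "real d \<le> (x' - a' - b') / r" using r by (simp add: neg_le_divide_eq algebra_simps)
  ultimately show ?thesis by linarith
qed (use assms in auto)

text \<open>More than \<open>k - N\<close> removed steps, each costing at least
  \<open>- lam\<close>, push the bound \<open>a + d * lam\<close> below \<open>u\<close>.\<close>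

lemma quot_mean_le_imp_le:
  fixes N :: nat
  assumes "lam < 0" "x \<noteq> -\<infinity>" "a \<le> 0"
    and x: "x \<le> a + ereal (real d) * lam"
    and k: "quot_mean (u - a) lam + ereal (real N) \<le> ereal (real k)" and kd: "k < N + d"
  shows "x \<le> u"
proof (cases lam)
  case MInf
  then have "d = 0" using x assms by (cases "d = 0"; cases a) auto
  then show ?thesis using k kd MInf by (simp add: quot_mean_def)
next
  case (real r)
  then have r: "r < 0" using assms by simp
  obtain a' where a: "a = ereal a'" using x assms real by (cases a) auto
  obtain x' where x': "x = ereal x'" using x assms real a by (cases x) auto
  show ?thesis
  proof (cases u)
    case (real u')
    have "(u' - a') / r + real N \<le> real k" using k real \<open>lam = ereal r\<close> a r by (simp add: quot_mean_def)
    then have "(u' - a') / r \<le> real d" using kd by linarith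
    then have "a' + real d * r \<le> u'" using r by (simp add: neg_divide_le_eq algebra_simps)
    then show ?thesis using x real \<open>lam = ereal r\<close> a x' by simp
  next
    case MInf
    \<comment> \<open>For \<open>u = -\<infinity>\<close> the bound would require \<open>k\<close>
      to be infinite, so the case is contradictory.\<close>
    then have "quot_mean (u - a) lam = \<infinity>"
      using quot_mean_minus_infty[of lam] assms(1) a \<open>lam = ereal r\<close> by simp
    then show ?thesis using k by simp
  qed simp
qed (use assms in auto)

section \<open>Products of matrices from the family\<close>

lemma strongly_connected_relpow:
  assumes "strongly_connected (with_proj G)" "a \<in> pverts G" "b \<in> pverts G"
  shows "\<exists>l. (a, b) \<in> parcs G ^^ l"
proof -
  have "reachable (with_proj G) a b" using assms by (auto simp: strongly_connected_def)
  then have "(a, b) \<in> (parcs G)\<^sup>*" using reachable_rtranclI by fastforce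
  then show ?thesis by (rule rtrancl_imp_relpow[THEN exE]) blast
qed

section \<open>Arcs, weights and cycle means common to the family\<close>

context critical_family
begin

abbreviation "M \<equiv> sup_mat X"
abbreviation "Nc \<equiv> pverts Cr"

lemma pverts_D: "pverts D = UNIV"
  using digraph_sup by (auto simp: mat_digraph_def)

lemma parcs_D: "(x, y) \<in> parcs D \<longleftrightarrow> M $ x $ y \<noteq> -\<infinity>"
  unfolding digraph_sup[symmetric] by (simp add: mat_digraph_def)

lemma critical_cycle_in_Cr:
  assumes "critical_cycle M p"
  shows "set p \<subseteq> Nc" "set (vwalk_arcs p) \<subseteq> parcs Cr"
  unfolding critical_sup[symmetric] critical_digraph_def using assms by auto

lemma parcs_Cr: "parcs Cr \<subseteq> Nc \<times> Nc" "parcs Cr \<subseteq> parcs D"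
proof -
  have "x \<in> Nc \<and> y \<in> Nc \<and> (x, y) \<in> parcs D" if xy: "(x, y) \<in> parcs Cr" for x y
  proof -
    obtain p where p: "critical_cycle M p" "(x, y) \<in> set (vwalk_arcs p)"
      using xy unfolding critical_sup[symmetric] critical_digraph_def by auto
    then have "(x, y) \<in> parcs D"
      unfolding digraph_sup[symmetric] critical_cycle_def closed_vwalk_mat_digraph by blast
    then show ?thesis using critical_cycle_in_Cr(1)[OF p(1)] p(2) by (auto elim: in_set_vwalk_arcsE)
  qed
  then show "parcs Cr \<subseteq> Nc \<times> Nc" "parcs Cr \<subseteq> parcs D" by auto
qed

lemma normalized_le:
  assumes "B \<in> normalized_family X"
  shows "B $ x $ y \<le> 0" "B $ x $ y \<le> M $ x $ y"
proof -
  show "B $ x $ y \<le> 0" using crit_entries[OF assms] noncrit_entries[OF assms] by (cases "(x, y) \<in> parcs Cr") auto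
  show "B $ x $ y \<le> M $ x $ y" using assms by (auto simp: sup_mat_def intro: SUP_upper)
qed

lemma normalized_arcs:
  assumes "B \<in> normalized_family X" "B $ x $ y \<noteq> -\<infinity>"
  shows "(x, y) \<in> parcs D"
  using normalized_le(2)[OF assms(1), of x y] assms(2) parcs_D by auto

lemma sup_le_0: "M $ x $ y \<le> 0"
proof -
  obtain B where "B \<in> normalized_family X" using nonempty by (auto simp: normalized_family_def)
  then show ?thesis using crit_entries noncrit_entries by (cases "(x, y) \<in> parcs Cr") auto
qed

lemma critical_arc_weight: "(x, y) \<in> parcs Cr \<Longrightarrow> M $ x $ y = 0"
  using nonempty crit_entries by (auto simp: normalized_family_def)

lemma D_connected: "\<exists>l. (a, b) \<in> parcs D ^^ l"
proof -
  obtain B where "B \<in> X" using nonempty by auto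
  then have "strongly_connected (with_proj D)" using irreducible digraph by (auto simp: irreducible_mat_def)
  then show ?thesis by (rule strongly_connected_relpow) (simp_all add: pverts_D)
qed

text \<open>All arcs of a critical cycle weigh \<open>0\<close>, and its mean is by definition the
  maximum cycle mean.\<close>

lemma sup_mean_0:
  assumes "Nc \<noteq> {}"
  shows "max_cycle_mean M = 0"
proof -
  obtain p where p: "critical_cycle M p" using assms unfolding critical_sup[symmetric] critical_digraph_def by auto
  have "vwalk_weight (mat_weight M) p = 0"
    using critical_cycle_in_Cr(2)[OF p]
    by (induction p rule: vwalk_arcs.induct) (auto simp: vwalk_weight_def mat_weight_def critical_arc_weight)
  then show ?thesis using p by (simp add: critical_cycle_def vwalk_mean_def)
qed

lemma Cr_cycle:
  assumes "Nc \<noteq> {}"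
  obtains z p where "z \<in> Nc" "0 < p" "(z, z) \<in> parcs Cr ^^ p"
proof -
  obtain p where p: "critical_cycle M p" using assms unfolding critical_sup[symmetric] critical_digraph_def by auto
  then have c: "p \<noteq> []" "hd p = last p" "1 \<le> length p - 1"
    unfolding critical_cycle_def closed_vwalk_mat_digraph by auto
  then have "(hd p, last p) \<in> parcs Cr ^^ (length p - 1)"
    using vwalk_arcs_relpow critical_cycle_in_Cr(2)[OF p] by blast
  moreover have "hd p \<in> Nc" using critical_cycle_in_Cr(1)[OF p] c(1) by auto
  ultimately show ?thesis using that[of "hd p" "length p - 1"] c by auto
qed

text \<open>A closed walk avoiding \<open>Nc\<close> with weight \<open>0\<close> would attain the
  maximum cycle mean of \<open>M\<close>, thus be critical and lie in \<open>Nc\<close>.\<close>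

lemma noncrit_mean_neg:
  assumes "Nc \<noteq> {}"
  shows "max_cycle_mean (noncrit_mat M Nc) < 0"
proof (rule max_cycle_mean_neg)
  let ?B = "noncrit_mat M Nc"
  fix p assume "closed_vwalk p (mat_digraph ?B)"
  then have p: "p \<noteq> []" "set (vwalk_arcs p) \<subseteq> parcs (mat_digraph ?B)" "hd p = last p" "1 \<le> length p - 1"
    unfolding closed_vwalk_mat_digraph by auto
  have avoid: "set xs \<inter> Nc = {}" if "set (vwalk_arcs xs) \<subseteq> parcs (mat_digraph ?B)" "2 \<le> length xs" for xs
    using that
  proof (induction xs rule: vwalk_arcs.induct)
    case (3 x y zs)
    then show ?case by (cases zs) (auto simp: mat_digraph_def noncrit_mat_def)
  qed auto
  have a: "set p \<inter> Nc = {}" using avoid[OF p(2)] p(4) by simp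
  have w: "vwalk_weight (mat_weight ?B) p = vwalk_weight (mat_weight M) p"
    using noncrit_mat_avoiding(1)[OF a] .
  have closed: "closed_vwalk p (mat_digraph M)"
    unfolding closed_vwalk_mat_digraph using p noncrit_mat_avoiding(2)[OF a] by blast
  have "vwalk_weight (mat_weight M) p \<noteq> 0"
  proof
    assume "vwalk_weight (mat_weight M) p = 0"
    then have "critical_cycle M p" using closed sup_mean_0[OF assms]
      by (simp add: critical_cycle_def vwalk_mean_def)
    then show False using critical_cycle_in_Cr(1)[of p] a p(1) by (cases p) auto
  qed
  then show "vwalk_weight (mat_weight ?B) p < 0"
    using vwalk_weight_le_0[OF sup_le_0, of p] w by (simp add: less_le)
qed

end

section \<open>Walks weighted by a product of \<open>k\<close> factors\<close>

locale critical_product = critical_family X D Cr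
  for X :: "'n::finite trop_mat set" and D Cr :: "'n pair_pre_digraph" +
  fixes A :: "nat \<Rightarrow> 'n trop_mat" and k :: nat
  assumes crit_conn: "strongly_connected (with_proj Cr)"
    and factors: "\<And>l. 1 \<le> l \<Longrightarrow> l \<le> k \<Longrightarrow> A l \<in> normalized_family X"
begin

abbreviation "to_crit \<equiv> opt_to_crit D Nc A k"
abbreviation "from_crit \<equiv> opt_from_crit D Nc A k"
abbreviation "G \<equiv> trop_product A k"

lemma Nc_nonempty: "Nc \<noteq> {}"
  using crit_conn by (simp add: strongly_connected_def)

lemma factor_le:
  assumes "s < l" "l < s + length xs" "s + length xs \<le> Suc k"
  shows "A l $ x $ y \<le> 0" "A l $ x $ y \<le> M $ x $ y"
  using normalized_le[OF factors[of l]] assms by auto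

lemma level_weight_nonpos: "s + length xs \<le> Suc k \<Longrightarrow> level_weight A s xs \<le> 0"
  using factor_le(1) by (intro level_weight_le_0) blast

lemma level_weight_le_sup:
  "s + length xs \<le> Suc k \<Longrightarrow> level_weight A s xs \<le> vwalk_weight (mat_weight M) xs"
  using factor_le(2) by (intro level_weight_le_vwalk_weight) blast

lemma level_weight_critical:
  assumes "s + length xs \<le> Suc k" "set (vwalk_arcs xs) \<subseteq> parcs Cr"
  shows "level_weight A s xs = 0"
  by (rule level_weight_zero[OF _ assms(2)]) (use assms(1) crit_entries factors in auto)

lemma to_crit_le_0: "to_crit i \<le> 0"
proof (cases "to_crit i = -\<infinity>")
  case False
  then obtain xs where "length xs \<le> Suc k" "level_weight A 0 xs = to_crit i"
    by (rule opt_to_crit_attained)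
  then show ?thesis using level_weight_nonpos[of 0 xs] by simp
qed simp

lemma from_crit_le_0: "from_crit j \<le> 0"
proof (cases "from_crit j = -\<infinity>")
  case False
  then obtain xs s where "s + length xs = Suc k" "level_weight A s xs = from_crit j"
    by (rule opt_from_crit_attained)
  then show ?thesis using level_weight_nonpos[of s xs] by simp
qed simp

lemma product_attained:
  assumes "G $ i $ j \<noteq> -\<infinity>"
  obtains xs where "length xs = Suc k" "hd xs = i" "last xs = j" "set (vwalk_arcs xs) \<subseteq> parcs D"
    "level_weight A 0 xs = G $ i $ j"
proof -
  have "A l $ x $ y \<noteq> \<infinity>" if "1 \<le> l" "l \<le> k" for l x y
    using normalized_le(1)[OF factors[OF that], of x y] by auto
  from trop_product_attained[OF this assms] obtain xs
    where xs: "length xs = Suc k" "hd xs = i" "last xs = j" "level_weight A 0 xs = G $ i $ j" by auto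
  have "set (vwalk_arcs xs) \<subseteq> parcs D"
  proof (rule level_weight_arcs)
    show "A l $ x $ y \<le> 0" if "0 < l" "l < 0 + length xs" for l x y
      using factor_le(1)[OF that] xs by simp
    show "(x, y) \<in> parcs D" if "0 < l" "l < 0 + length xs" "A l $ x $ y \<noteq> -\<infinity>" for l x y
      using normalized_arcs[OF factors[of l] that(3)] that xs by simp
    show "level_weight A 0 xs \<noteq> -\<infinity>" using xs(4) assms by simp
  qed
  then show ?thesis using that xs by blast
qed

text \<open>The walk is cut at its first and its last visit to \<open>Nc\<close>, which may
  coincide. The outer pieces compete in the definitions of the two optima, and the middle piece
  weighs at most \<open>0\<close>.\<close>

lemma visiting_walk_le:
  assumes "length xs = Suc k" "set (vwalk_arcs xs) \<subseteq> parcs D" "set xs \<inter> Nc \<noteq> {}"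
  shows "level_weight A 0 xs \<le> to_crit (hd xs) + from_crit (last xs)"
proof -
  have "\<exists>x\<in>set xs. x \<in> Nc" using assms(3) by auto
  then obtain p a r where p: "xs = p @ a # r" "a \<in> Nc" "\<forall>x\<in>set p. x \<notin> Nc"
    by (rule split_list_first_propE)
  have "\<exists>x\<in>set (a # r). x \<in> Nc" using p(2) by auto
  then obtain p' b r' where r: "a # r = p' @ b # r'" "b \<in> Nc" "\<forall>x\<in>set r'. x \<notin> Nc"
    by (rule split_list_last_propE)
  have len: "length xs = length p + length (p' @ b # r')" unfolding p(1) r(1)[symmetric] by simp
  have arcs: "set (vwalk_arcs (p @ [a])) \<subseteq> parcs D" "set (vwalk_arcs (b # r')) \<subseteq> parcs D"
  proof -
    have 1: "set (vwalk_arcs (p @ [a])) \<union> set (vwalk_arcs (a # r)) \<subseteq> parcs D"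
      using assms(2) unfolding p(1) vwalk_arcs_append_mid[of p a r] .
    then show "set (vwalk_arcs (p @ [a])) \<subseteq> parcs D" by blast
    have "set (vwalk_arcs (a # r)) \<subseteq> parcs D" using 1 by blast
    then show "set (vwalk_arcs (b # r')) \<subseteq> parcs D"
      unfolding r(1) vwalk_arcs_append_mid[of p' b r'] by blast
  qed
  have "level_weight A 0 (p @ [a]) \<le> to_crit (hd (p @ [a]))"
    by (rule opt_to_crit_ge) (use arcs(1) p len assms(1) in auto)
  moreover have "hd (p @ [a]) = hd xs" by (simp add: p(1) hd_append)
  moreover have "level_weight A (length p + length p') (b # r') \<le> from_crit (last (b # r'))"
    by (rule opt_from_crit_ge) (use arcs(2) r len assms(1) in auto)
  moreover have "last (b # r') = last xs"
  proof -
    have "last xs = last (a # r)" by (simp add: p(1))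
    then show ?thesis unfolding r(1) by simp
  qed
  moreover have "level_weight A (length p) (p' @ [b]) \<le> 0"
    using len assms(1) by (intro level_weight_nonpos) simp
  moreover have "level_weight A (length p) (a # r) =
      level_weight A (length p) (p' @ [b]) + level_weight A (length p + length p') (b # r')"
    unfolding r(1) by (rule level_weight_append)
  then have "level_weight A 0 xs = level_weight A 0 (p @ [a]) +
      (level_weight A (length p) (p' @ [b]) + level_weight A (length p + length p') (b # r'))"
    using level_weight_append[of A 0 p a r] p(1) by simp
  ultimately show ?thesis
    using add_mono[of "level_weight A 0 (p @ [a])" "to_crit (hd xs)"
        "level_weight A (length p) (p' @ [b]) + level_weight A (length p + length p') (b # r')"
        "0 + from_crit (last xs)"] add_mono[of "level_weight A (length p) (p' @ [b])" 0
        "level_weight A (length p + length p') (b # r')" "from_crit (last xs)"]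
    by simp
qed

lemma product_to_crit_le:
  assumes "a \<in> Nc"
  shows "G $ i $ a \<le> to_crit i"
proof (cases "G $ i $ a = -\<infinity>")
  case False
  then obtain xs where xs: "length xs = Suc k" "hd xs = i" "last xs = a"
    "set (vwalk_arcs xs) \<subseteq> parcs D" "level_weight A 0 xs = G $ i $ a" by (rule product_attained)
  have "a \<in> set xs" using xs(1,3) by (cases xs rule: rev_cases) auto
  then have "G $ i $ a \<le> to_crit i + from_crit a" using visiting_walk_le[OF xs(1,4)] xs assms by auto
  also have "\<dots> \<le> to_crit i + 0" by (rule add_left_mono) (rule from_crit_le_0)
  finally show ?thesis by simp
qed simp

lemma product_from_crit_le:
  assumes "b \<in> Nc"
  shows "G $ b $ j \<le> from_crit j"
proof (cases "G $ b $ j = -\<infinity>")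
  case False
  then obtain xs where xs: "length xs = Suc k" "hd xs = b" "last xs = j"
    "set (vwalk_arcs xs) \<subseteq> parcs D" "level_weight A 0 xs = G $ b $ j" by (rule product_attained)
  have "b \<in> set xs" using xs(1,2) by (cases xs) auto
  then have "G $ b $ j \<le> to_crit b + from_crit j" using visiting_walk_le[OF xs(1,4)] xs assms by auto
  also have "\<dots> \<le> 0 + from_crit j" by (rule add_right_mono) (rule to_crit_le_0)
  finally show ?thesis by simp
qed simp

text \<open>A critical walk placed between \<open>xs\<close> and \<open>ys\<close> costs nothing at
  any level. The lengths count nodes: the steps \<open>length xs - 1\<close>, \<open>l\<close> and
  \<open>length ys - 1\<close> add up to \<open>k\<close>, and \<open>Suc k - length ys\<close> is
  the level where \<open>ys\<close> starts. A one-node \<open>xs\<close> or \<open>ys\<close> covers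
  prolonging an optimal walk at one end.\<close>

lemma product_fill:
  assumes "xs \<noteq> []" "ys \<noteq> []" "(last xs, hd ys) \<in> parcs Cr ^^ l"
    and len: "length xs + l + length ys = k + 2"
  shows "level_weight A 0 xs + level_weight A (Suc k - length ys) ys \<le> G $ hd xs $ last ys"
proof -
  obtain zs where zs: "length zs = Suc l" "hd zs = last xs" "last zs = hd ys"
    "set (vwalk_arcs zs) \<subseteq> parcs Cr" by (rule relpow_vwalk_arcs[OF assms(3)])
  have zne: "zs \<noteq> []" using zs(1) by auto
  have x1: "1 \<le> length xs" "1 \<le> length ys" using assms(1,2) by (simp_all add: Suc_le_eq)
  define us where "us = zs @ tl ys"
  have us: "us \<noteq> []" "hd us = last xs" using zne zs(2) by (auto simp: us_def)
  have lu: "last us = last ys"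
    using zs(3) zne assms(2) by (cases ys) (auto simp: us_def)
  have lw_us: "level_weight A s us = level_weight A s zs + level_weight A (s + l) ys" for s
    unfolding us_def using level_weight_glue[OF zne assms(2) zs(3), of A s] zs(1) by simp
  have "level_weight A (length xs - 1) zs = 0"
    by (rule level_weight_critical) (use zs len x1 in auto)
  moreover have "level_weight A 0 (xs @ tl us) = level_weight A 0 xs + level_weight A (length xs - 1) us"
    using level_weight_glue[OF assms(1) us(1) us(2)[symmetric], of A 0] by simp
  moreover have "length xs - 1 + l = Suc k - length ys" using len x1 by linarith
  ultimately have "level_weight A 0 (xs @ tl us) = level_weight A 0 xs + level_weight A (Suc k - length ys) ys"
    by (simp add: lw_us)
  moreover have "length (xs @ tl us) = Suc k" using len x1 zs(1) by (simp add: us_def)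
  moreover have "hd (xs @ tl us) = hd xs" using assms(1) by simp
  moreover have "last (xs @ tl us) = last ys"
  proof (cases "tl us")
    case Nil
    then have "us = [hd us]" using us(1) by (cases us) auto
    then show ?thesis using us(2) lu Nil by (metis append_Nil2 last.simps)
  next
    case Cons
    then have "tl us \<noteq> []" by simp
    then show ?thesis using lu last_tl[of us] by simp
  qed
  ultimately show ?thesis using trop_product_ge[of "xs @ tl us" k A] by simp
qed

end

text \<open>\<open>power_transient\<close> is a \<open>LEAST\<close> and has its defining property
  only once some threshold is known to exist, hence \<open>ex\<close>.\<close>

lemma power_transient_period:
  assumes ex: "\<exists>T. \<forall>l\<ge>T. trop_power S (l + g) = trop_power S l" and l: "power_transient S g \<le> l"
  shows "trop_power S (l + m * g) = trop_power S l"
proof -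
  have per: "\<forall>l\<ge>power_transient S g. trop_power S (l + g) = trop_power S l"
    unfolding power_transient_def using ex by (rule LeastI_ex)
  show ?thesis
  proof (induction m)
    case (Suc m)
    have "trop_power S (l + m * g + g) = trop_power S (l + m * g)" using per l by simp
    then show ?case using Suc by (simp add: ac_simps)
  qed simp
qed

lemma ereal_summands_finite:
  fixes a b x :: ereal
  assumes "x \<le> a + b" "x \<noteq> -\<infinity>" "a \<le> 0" "b \<le> 0"
  shows "a \<noteq> -\<infinity>" "b \<noteq> -\<infinity>"
  using assms by (cases a; cases b; auto)+

section \<open>Cyclic classes and the gap between optimal walks\<close>

context critical_product
begin

abbreviation "g \<equiv> cyclicity Cr"
abbreviation "lam \<equiv> max_cycle_mean (noncrit_mat M Nc)"

lemma g_pos: "1 \<le> g"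
proof -
  obtain z p where "0 < p" "(z, z) \<in> parcs Cr ^^ p" using Cr_cycle[OF Nc_nonempty] by blast
  then show ?thesis unfolding cyclicity_relpow[OF parcs_Cr(1)]
    using Gcd_closed_walks_pos by (simp add: Suc_le_eq)
qed

text \<open>The classes are built from \<open>D\<close>, so every walk respects them; the eventual
  existence of critical walks is governed by the cyclicity of \<open>Cr\<close>. Equality of the two
  cyclicities lets one \<open>c\<close> serve both purposes.\<close>

lemma classes:
  assumes "g = cyclicity D"
  obtains c :: "'n \<Rightarrow> nat" where "\<And>x y. (x, y) \<in> parcs D \<Longrightarrow> [c y = c x + 1] (mod g)"
    "\<And>a b. a \<in> Nc \<Longrightarrow> b \<in> Nc \<Longrightarrow> \<exists>N. \<forall>l\<ge>N. [c b = c a + l] (mod g) \<longrightarrow> (a, b) \<in> parcs Cr ^^ l"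
proof -
  obtain z p where z: "z \<in> Nc" "0 < p" "(z, z) \<in> parcs Cr ^^ p" using Cr_cycle[OF Nc_nonempty] by blast
  have dvd: "g dvd l" if vl: "(v, v) \<in> parcs D ^^ l" for v l
  proof (cases "l = 0")
    case False
    then have l: "l \<in> {l. 1 \<le> l \<and> (\<exists>v. (v, v) \<in> parcs D ^^ l)}" using vl by auto
    have sub: "parcs D \<subseteq> pverts D \<times> pverts D" by (simp add: pverts_D)
    show ?thesis unfolding assms cyclicity_relpow[OF sub] using l by (rule Gcd_dvd)
  qed simp
  obtain c :: "'n \<Rightarrow> nat" where c: "\<And>x y. (x, y) \<in> parcs D \<Longrightarrow> [c y = c x + 1] (mod g)"
    by (rule cyclic_classes[of z "parcs D" g, OF D_connected D_connected]) (erule dvd, blast)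
  have "\<exists>N. \<forall>l\<ge>N. [c b = c a + l] (mod g) \<longrightarrow> (a, b) \<in> parcs Cr ^^ l" if ab: "a \<in> Nc" "b \<in> Nc" for a b
  proof -
    have conn: "\<exists>l. (x, y) \<in> parcs Cr ^^ l" if "x \<in> Nc" "y \<in> Nc" for x y
      using strongly_connected_relpow[OF crit_conn that] .
    then obtain l0 where l0: "(a, b) \<in> parcs Cr ^^ l0" using ab by blast
    obtain N where N: "\<forall>l\<ge>N. [l = l0] (mod g) \<longrightarrow> (a, b) \<in> parcs Cr ^^ l"
      using eventually_walks[OF conn parcs_Cr(1) z(1,3,2) cyclicity_relpow[OF parcs_Cr(1)] ab l0] by blast
    have "[c b = c a + l0] (mod g)"
      by (rule cong_relpow[OF _ l0]) (use c parcs_Cr(2) in blast)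
    then have "[l = l0] (mod g)" if "[c b = c a + l] (mod g)" for l
      using that by (metis cong_add_lcancel_nat cong_sym cong_trans)
    then show ?thesis using N by blast
  qed
  then show ?thesis using that c by blast
qed

text \<open>A sufficiently long closed critical walk at \<open>a\<close> has an initial and a final
  segment of length \<open>l\<close>.\<close>

lemma critical_walk_exists:
  assumes ev: "\<And>a b. a \<in> Nc \<Longrightarrow> b \<in> Nc \<Longrightarrow>
      \<exists>N. \<forall>l\<ge>N. [c b = c a + l] (mod g) \<longrightarrow> (a, b) \<in> parcs Cr ^^ l"
    and a: "a \<in> Nc"
  shows "\<exists>b\<in>Nc. (a, b) \<in> parcs Cr ^^ l" "\<exists>b\<in>Nc. (b, a) \<in> parcs Cr ^^ l"
proof -
  obtain N where N: "\<forall>l\<ge>N. [c a = c a + l] (mod g) \<longrightarrow> (a, a) \<in> parcs Cr ^^ l"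
    using ev[OF a a] by blast
  define n where "n = g * (N + l)"
  have n: "N + l \<le> n" using g_pos by (simp add: n_def)
  have "[c a = c a + n] (mod g)" by (simp add: n_def cong_def)
  then have "(a, a) \<in> parcs Cr ^^ n" using N n by simp
  then obtain b b' where b: "(a, b) \<in> parcs Cr ^^ l" "(b', a) \<in> parcs Cr ^^ (n - (n - l))"
    using n relpow_split[of a a n "parcs Cr" l] relpow_split[of a a n "parcs Cr" "n - l"]
    by (metis add_leD2 diff_le_self)
  show "\<exists>b\<in>Nc. (a, b) \<in> parcs Cr ^^ l" using b(1) relpow_target_in[OF parcs_Cr(1) b(1) a] by blast
  show "\<exists>b\<in>Nc. (b, a) \<in> parcs Cr ^^ l"
    using b(2) relpow_source_in[OF parcs_Cr(1) b(2) a] n by auto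
qed

lemma product_to_crit_ge:
  assumes ev: "\<And>a b. a \<in> Nc \<Longrightarrow> b \<in> Nc \<Longrightarrow>
      \<exists>N. \<forall>l\<ge>N. [c b = c a + l] (mod g) \<longrightarrow> (a, b) \<in> parcs Cr ^^ l"
    and i: "to_crit i \<noteq> -\<infinity>"
  obtains a where "a \<in> Nc" "to_crit i \<le> G $ i $ a"
proof -
  obtain xs where xs: "xs \<noteq> []" "length xs \<le> Suc k" "last xs \<in> Nc" "hd xs = i"
    "level_weight A 0 xs = to_crit i" by (rule opt_to_crit_attained[OF i])
  obtain a where a: "a \<in> Nc" "(last xs, a) \<in> parcs Cr ^^ (Suc k - length xs)"
    using critical_walk_exists(1)[OF ev xs(3)] by blast
  have "level_weight A 0 xs + level_weight A (Suc k - length [a]) [a] \<le> G $ hd xs $ last [a]"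
    by (rule product_fill[OF xs(1) _ _ , of _ "Suc k - length xs"]) (use a(2) xs(2) in auto)
  then show ?thesis using that[OF a(1)] xs by simp
qed

lemma product_from_crit_ge:
  assumes ev: "\<And>a b. a \<in> Nc \<Longrightarrow> b \<in> Nc \<Longrightarrow>
      \<exists>N. \<forall>l\<ge>N. [c b = c a + l] (mod g) \<longrightarrow> (a, b) \<in> parcs Cr ^^ l"
    and j: "from_crit j \<noteq> -\<infinity>"
  obtains b where "b \<in> Nc" "from_crit j \<le> G $ b $ j"
proof -
  obtain ys s where ys: "ys \<noteq> []" "s + length ys = Suc k" "hd ys \<in> Nc" "last ys = j"
    "level_weight A s ys = from_crit j" by (rule opt_from_crit_attained[OF j])
  obtain b where b: "b \<in> Nc" "(b, hd ys) \<in> parcs Cr ^^ s"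
    using critical_walk_exists(2)[OF ev ys(3)] by blast
  have "level_weight A 0 [b] + level_weight A (Suc k - length ys) ys \<le> G $ hd [b] $ last ys"
    by (rule product_fill[OF _ ys(1), of _ s]) (use b(2) ys(2) in auto)
  moreover have "Suc k - length ys = s" using ys(2) by linarith
  ultimately show ?thesis using that[OF b(1)] ys(4,5) by simp
qed

text \<open>Reducing both walks to paths removes \<open>d\<close> and \<open>e\<close> steps, and
  the bound forces \<open>(d + e) + 2 * (CARD('n) - card Nc) + N \<le> k\<close>. The walks have at
  most \<open>CARD('n) - card Nc\<close> steps more than \<open>d\<close> and \<open>e\<close>, so
  \<open>N\<close> levels stay free; the \<open>2\<close> in the conclusion converts nodes into
  steps.\<close>

lemma optimal_walks_gap:
  assumes xs: "xs \<noteq> []" "set (vwalk_arcs xs) \<subseteq> parcs D" "length xs \<le> Suc k" "last xs \<in> Nc"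
      "set (butlast xs) \<inter> Nc = {}" "hd xs = i" "level_weight A 0 xs = to_crit i"
    and ys: "ys \<noteq> []" "set (vwalk_arcs ys) \<subseteq> parcs D" "s + length ys = Suc k" "hd ys \<in> Nc"
      "set (tl ys) \<inter> Nc = {}" "last ys = j" "level_weight A s ys = from_crit j"
    and fin: "to_crit i \<noteq> -\<infinity>" "from_crit j \<noteq> -\<infinity>"
    and bound: "quot_mean (to_crit i + from_crit j - path_to_crit M Nc i - path_from_crit M Nc j) lam
      + ereal (real (2 * (CARD('n) - card Nc) + N)) \<le> ereal (real k)"
  shows "length xs + length ys + N \<le> k + 2"
proof -
  obtain d where d: "length xs \<le> Suc (CARD('n) - card Nc) + d"
    "vwalk_weight (mat_weight M) xs \<le> path_to_crit M Nc (hd xs) + ereal (real d) * lam"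
    using to_crit_reduce[OF xs(1) _ xs(4,5), of M] xs(2) digraph_sup by auto
  obtain e where e: "length ys \<le> Suc (CARD('n) - card Nc) + e"
    "vwalk_weight (mat_weight M) ys \<le> path_from_crit M Nc (last ys) + ereal (real e) * lam"
    using from_crit_reduce[OF ys(1) _ ys(4,5), of M] ys(2) digraph_sup by auto
  have 1: "to_crit i \<le> path_to_crit M Nc i + ereal (real d) * lam"
    using level_weight_le_sup[of 0 xs] xs d(2) by simp
  have 2: "from_crit j \<le> path_from_crit M Nc j + ereal (real e) * lam"
    using level_weight_le_sup[of s ys] ys e(2) by simp
  have "to_crit i + from_crit j \<le> (path_to_crit M Nc i + ereal (real d) * lam)
      + (path_from_crit M Nc j + ereal (real e) * lam)"
    using 1 2 by (rule add_mono)
  also have "\<dots> = path_to_crit M Nc i + path_from_crit M Nc j + (ereal (real d) + ereal (real e)) * lam"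
    by (subst ereal_left_distrib) (auto simp: ac_simps)
  also have "ereal (real d) + ereal (real e) = ereal (real (d + e))" by simp
  finally have le: "to_crit i + from_crit j \<le>
    path_to_crit M Nc i + path_from_crit M Nc j + ereal (real (d + e)) * lam" .
  have "to_crit i + from_crit j \<noteq> -\<infinity>"
    using fin to_crit_le_0[of i] from_crit_le_0[of j] by auto
  then have "(d + e) + (2 * (CARD('n) - card Nc) + N) \<le> k"
    using quot_mean_le_imp[OF noncrit_mean_neg[OF Nc_nonempty] _ path_to_crit_le_0[OF sup_le_0]
        path_from_crit_le_0[OF sup_le_0] le bound] by blast
  then show ?thesis using d(1) e(1) by linarith
qed

lemma product_le_opt:
  assumes k: "1 \<le> k" and ij: "G $ i $ j \<noteq> -\<infinity>"
    and bound: "path_avoiding M Nc i j > -\<infinity> \<Longrightarrow>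
      quot_mean (to_crit i + from_crit j - path_avoiding M Nc i j) lam
        + ereal (real (CARD('n) - card Nc + 1)) \<le> ereal (real k)"
  shows "G $ i $ j \<le> to_crit i + from_crit j"
proof -
  obtain xs where xs: "length xs = Suc k" "hd xs = i" "last xs = j" "set (vwalk_arcs xs) \<subseteq> parcs D"
    "level_weight A 0 xs = G $ i $ j" by (rule product_attained[OF ij])
  show ?thesis
  proof (cases "set xs \<inter> Nc = {}")
    case False
    then show ?thesis using visiting_walk_le[OF xs(1,4)] xs by simp
  next
    case True
    have arcs: "set (vwalk_arcs xs) \<subseteq> parcs (mat_digraph M)" using xs(4) digraph_sup by simp
    \<comment> \<open>For \<open>i = j\<close> the weight \<open>path_avoiding\<close> refers to
      cycles of positive length, so a walk consisting of a single node must be excluded.\<close>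
    have "2 \<le> length xs" using xs(1) k by simp
    from avoiding_reduce[OF sup_le_0 this arcs True] obtain d where
      d: "length xs \<le> Suc (CARD('n) - card Nc) + d"
        "vwalk_weight (mat_weight M) xs \<le> path_avoiding M Nc (hd xs) (last xs) + ereal (real d) * lam"
        "path_avoiding M Nc (hd xs) (last xs) \<noteq> -\<infinity>"
      by blast
    have le: "G $ i $ j \<le> path_avoiding M Nc i j + ereal (real d) * lam"
      using level_weight_le_sup[of 0 xs] d(2) xs by simp
    have "path_avoiding M Nc i j > -\<infinity>" using d(3) xs by (simp add: less_le)
    from bound[OF this] show ?thesis
      by (rule quot_mean_le_imp_le[OF noncrit_mean_neg[OF Nc_nonempty] ij path_avoiding_le_0[OF sup_le_0] le])
        (use d(1) xs(1) in simp)
  qed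
qed

end

section \<open>Comparison of the product with its CSR term\<close>

theorem theorem5p8:
  fixes X :: "'n::finite trop_mat set"
    and D Cr :: "'n pair_pre_digraph"
    and A :: "nat \<Rightarrow> 'n trop_mat"
    and Nc :: "'n set"
    and n q k t g :: nat
    and u :: "'n \<Rightarrow> 'n \<Rightarrow> ereal"
    and lam :: ereal
  assumes family: "critical_family X D Cr"
    and n: "n = CARD('n)"
    and Nc: "Nc = pverts Cr"
    and q: "q = card Nc"
    and crit_conn: "strongly_connected (with_proj Cr)"
    and g: "g = cyclicity Cr"
    and g_eq: "g = cyclicity D"
    and k: "k \<ge> 1"
    and A: "\<And>l. 1 \<le> l \<Longrightarrow> l \<le> k \<Longrightarrow> A l \<in> normalized_family X"
    and t: "t * g \<ge> power_transient (crit_mat Cr) g"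
    and u: "\<And>i j. u i j = opt_to_crit D Nc A k i + opt_from_crit D Nc A k j"
    and lam: "lam = max_cycle_mean (noncrit_mat (sup_mat X) Nc)"
    and bound: "ereal (real k) \<ge>
      max (SUP (i, j)\<in>UNIV.
             quot_mean (u i j - path_to_crit (sup_mat X) Nc i - path_from_crit (sup_mat X) Nc j) lam
             + ereal (real (2 * (n - q) + Sch g q)))
          (SUP (i, j)\<in>{(i, j). path_avoiding (sup_mat X) Nc i j > -\<infinity>}.
             quot_mean (u i j - path_avoiding (sup_mat X) Nc i j) lam
             + ereal (real (n - q + 1)))"
  shows "trop_product A k = csr Cr t k (trop_product A k)"
proof -
  interpret critical_product X D Cr A k
    using family crit_conn A by (simp add: critical_product_def critical_product_axioms_def)
  let ?G = "trop_product A k" and ?M = "sup_mat X" and ?E = "parcs Cr"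
  have b1: "quot_mean (u i j - path_to_crit ?M Nc i - path_from_crit ?M Nc j) lam
      + ereal (real (2 * (n - q) + Sch g q)) \<le> ereal (real k)" for i j
    using bound unfolding max.bounded_iff SUP_le_iff by auto
  have b2: "quot_mean (u i j - path_avoiding ?M Nc i j) lam + ereal (real (n - q + 1)) \<le> ereal (real k)"
    if "path_avoiding ?M Nc i j > -\<infinity>" for i j
    using bound that unfolding max.bounded_iff SUP_le_iff by auto
  have g1: "1 \<le> g" using g_pos g by simp
  obtain c :: "'n \<Rightarrow> nat" where cD: "\<And>x y. (x, y) \<in> parcs D \<Longrightarrow> [c y = c x + 1] (mod cyclicity Cr)"
    and ev: "\<And>a b. a \<in> pverts Cr \<Longrightarrow> b \<in> pverts Cr \<Longrightarrow>
      \<exists>N. \<forall>l\<ge>N. [c b = c a + l] (mod cyclicity Cr) \<longrightarrow> (a, b) \<in> ?E ^^ l"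
    using classes g g_eq by metis
  have cl: "[c y = c x + l] (mod g)" if "(x, y) \<in> parcs D ^^ l" for x y l
    using cong_relpow[OF _ that, of c g] cD g by simp
  have clE: "[c y = c x + l] (mod g)" if "(x, y) \<in> ?E ^^ l" for x y l
    using cong_relpow[OF _ that, of c g] cD g parcs_Cr(2) by blast
  have sch: "(a, b) \<in> ?E ^^ l"
    if "a \<in> pverts Cr" "b \<in> pverts Cr" "Sch g q \<le> l" "[c b = c a + l] (mod g)" for a b l
    by (rule schwarz_bound[of "pverts Cr" ?E g c])
      (use parcs_Cr g1 cD ev that g q Nc in auto)
  have ends: "a \<in> Nc \<and> b \<in> Nc" if ab: "(a, b) \<in> ?E ^^ l" and l: "1 \<le> l" for a b l
  proof -
    obtain m where m: "l = Suc m" using l by (cases l) auto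
    then obtain x y where "(a, x) \<in> ?E" "(y, b) \<in> ?E"
      using ab relpow_Suc_D2[of a b m ?E] relpow_Suc_E[of a b m ?E] by metis
    then show ?thesis using parcs_Cr(1) Nc by auto
  qed
  \<comment> \<open>This is the total length of the critical walk encoded by the three powers of
    \<open>S\<close> in the CSR term.\<close>
  define L where "L = 2 * ((t + 1) * g - k mod g) + k mod g"
  have kg: "k mod g < g" using g1 by simp
  have tg: "(t + 1) * g = t * g + g" by simp
  have L1: "1 \<le> L" and Lt: "t * g \<le> L" using kg tg unfolding L_def by linarith+
  \<comment> \<open>The two product walks and the critical walk have \<open>k + L + k\<close> steps
    in all, so this is what gives them the residue of \<open>k\<close>.\<close>
  have Lk: "[L + k = 0] (mod g)"
  proof -
    have "L + k mod g = 2 * ((t + 1) * g)" using kg tg unfolding L_def by linarith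
    then have "[L + k mod g = 0] (mod g)" by (simp add: cong_def)
    then show ?thesis by (simp add: cong_def mod_add_right_eq)
  qed
  have period: "\<exists>T. \<forall>l\<ge>T. trop_power (crit_mat Cr) (l + g) = trop_power (crit_mat Cr) l"
  proof (intro exI allI impI)
    \<comment> \<open>The \<open>+ 1\<close> excludes walks of length \<open>0\<close>, which exist
      at every node; walks with an arc have both ends in \<open>Nc\<close>.\<close>
    fix l assume l: "Sch g q + 1 \<le> l"
    have iff: "(a, b) \<in> ?E ^^ m \<longleftrightarrow> a \<in> Nc \<and> b \<in> Nc \<and> [c b = c a + m] (mod g)"
      if m: "Sch g q + 1 \<le> m" for a b m
    proof
      assume "(a, b) \<in> ?E ^^ m"
      then show "a \<in> Nc \<and> b \<in> Nc \<and> [c b = c a + m] (mod g)"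
        using ends[of a b m] clE[of a b m] m by simp
    next
      assume "a \<in> Nc \<and> b \<in> Nc \<and> [c b = c a + m] (mod g)"
      then show "(a, b) \<in> ?E ^^ m" using sch[of a b m] m Nc by simp
    qed
    have "[c b = c a + (l + g)] (mod g) \<longleftrightarrow> [c b = c a + l] (mod g)" for a b
      by (simp add: cong_def flip: add.assoc)
    then have "(a, b) \<in> ?E ^^ (l + g) \<longleftrightarrow> (a, b) \<in> ?E ^^ l" for a b
      using iff[OF l] iff[OF trans_le_add1[OF l]] by simp
    then show "trop_power (crit_mat Cr) (l + g) = trop_power (crit_mat Cr) l"
      by (simp add: vec_eq_iff trop_power_crit_mat)
  qed
  have walkL: "(a, b) \<in> ?E ^^ L" if ab: "a \<in> Nc" "b \<in> Nc" "[c b = c a + L] (mod g)" for a b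
  proof -
    \<comment> \<open>\<open>L\<close> need not reach Schwarz's bound. The bound is applied to
      \<open>L\<close> plus a multiple of \<open>g\<close>, and periodicity from
      \<open>t * g \<le> L\<close> on brings the walk back to length \<open>L\<close>.\<close>
    have "[c a + (L + Sch g q * g) = c a + L] (mod g)" by (simp add: cong_def flip: add.assoc)
    then have "[c b = c a + (L + Sch g q * g)] (mod g)" using ab(3) cong_sym cong_trans by blast
    moreover have "Sch g q \<le> L + Sch g q * g" using g1 by (simp add: trans_le_add2)
    ultimately have "(a, b) \<in> ?E ^^ (L + Sch g q * g)" using sch ab Nc by blast
    then have "trop_power (crit_mat Cr) (L + Sch g q * g) $ a $ b = 0" by (simp add: trop_power_crit_mat)
    moreover have "trop_power (crit_mat Cr) (L + Sch g q * g) = trop_power (crit_mat Cr) L"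
      by (rule power_transient_period[OF period]) (use t Lt in linarith)
    ultimately show ?thesis by (simp add: trop_power_crit_mat split: if_splits)
  qed
  have G_cong: "[c y = c x + k] (mod g)" if xy: "?G $ x $ y \<noteq> -\<infinity>" for x y
  proof -
    obtain xs where xs: "length xs = Suc k" "hd xs = x" "last xs = y" "set (vwalk_arcs xs) \<subseteq> parcs D"
      by (rule product_attained[OF xy])
    then have "xs \<noteq> []" by auto
    then show ?thesis using cl[OF vwalk_arcs_relpow[of xs "parcs D"]] xs by simp
  qed
  have G_le_0: "?G $ x $ y \<le> 0" for x y
  proof (cases "?G $ x $ y = -\<infinity>")
    case False
    then obtain xs where "length xs = Suc k" "level_weight A 0 xs = ?G $ x $ y" by (rule product_attained)
    then show ?thesis using level_weight_nonpos[of 0 xs] by simp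
  qed simp
  have le: "?G $ i $ j \<le> csr Cr t k ?G $ i $ j" for i j
  proof (cases "?G $ i $ j = -\<infinity>")
    case False
    have Gu: "?G $ i $ j \<le> to_crit i + from_crit j"
      by (rule product_le_opt[OF k False]) (use b2[of i j] in \<open>simp add: u lam n q Nc\<close>)
    have fin: "to_crit i \<noteq> -\<infinity>" "from_crit j \<noteq> -\<infinity>"
      using ereal_summands_finite[OF Gu False to_crit_le_0 from_crit_le_0] by auto
    obtain a where a: "a \<in> pverts Cr" "to_crit i \<le> ?G $ i $ a" by (rule product_to_crit_ge[OF ev fin(1)])
    obtain b where b: "b \<in> pverts Cr" "from_crit j \<le> ?G $ b $ j" by (rule product_from_crit_ge[OF ev fin(2)])
    have "?G $ i $ a \<noteq> -\<infinity>" "?G $ b $ j \<noteq> -\<infinity>" using a(2) b(2) fin by auto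
    then have c1: "[c a = c i + k] (mod g)" "[c j = c b + k] (mod g)" "[c j = c i + k] (mod g)"
      using G_cong False by auto
    \<comment> \<open>Finiteness of the three product entries fixes all residues, and they leave
      exactly the residue of \<open>L\<close> for a critical walk from \<open>a\<close> to
      \<open>b\<close>.\<close>
    have "[c b + k = c j] (mod g)" using c1(2) by (rule cong_sym)
    also have "[c j = c a] (mod g)" using c1(1,3) cong_sym cong_trans by blast
    also have "[c a = c a + (L + k)] (mod g)"
      using cong_add[OF cong_refl[of "c a"] cong_sym[OF Lk]] by simp
    finally have "[c b + k = (c a + L) + k] (mod g)" by (simp add: add.assoc)
    then have "[c b = c a + L] (mod g)" by (simp only: cong_add_rcancel_nat)
    then have "(a, b) \<in> ?E ^^ L" using walkL a(1) b(1) Nc by blast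
    then have "?G $ i $ a + ?G $ b $ j \<le> csr Cr t k ?G $ i $ j"
      unfolding L_def by (rule csr_ge[OF g])
    then show ?thesis using Gu add_mono[OF a(2) b(2)] by (meson order_trans)
  qed simp
  have ge: "csr Cr t k ?G $ i $ j \<le> ?G $ i $ j" for i j
  proof (cases "csr Cr t k ?G $ i $ j = -\<infinity>")
    case False
    have "?G $ x $ y \<noteq> \<infinity>" for x y using G_le_0[of x y] by auto
    from csr_attained[OF g this False] obtain a b where ab: "(a, b) \<in> ?E ^^ L"
      and csr: "csr Cr t k ?G $ i $ j = ?G $ i $ a + ?G $ b $ j" unfolding L_def by blast
    have Nab: "a \<in> pverts Cr" "b \<in> pverts Cr" using ends[OF ab L1] Nc by auto
    have Gab: "?G $ i $ a \<noteq> -\<infinity>" "?G $ b $ j \<noteq> -\<infinity>"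
      using ereal_summands_finite[OF eq_refl[OF csr] False G_le_0 G_le_0] by auto
    have csr_le: "csr Cr t k ?G $ i $ j \<le> to_crit i + from_crit j"
      unfolding csr by (rule add_mono[OF product_to_crit_le[OF Nab(1)] product_from_crit_le[OF Nab(2)]])
    have fin: "to_crit i \<noteq> -\<infinity>" "from_crit j \<noteq> -\<infinity>"
      using ereal_summands_finite[OF csr_le False to_crit_le_0 from_crit_le_0] by auto
    obtain xs where xs: "xs \<noteq> []" "set (vwalk_arcs xs) \<subseteq> parcs D" "length xs \<le> Suc k"
      "last xs \<in> pverts Cr" "set (butlast xs) \<inter> pverts Cr = {}" "hd xs = i"
      "level_weight A 0 xs = to_crit i" by (rule opt_to_crit_attained[OF fin(1)])
    obtain ys s where ys: "ys \<noteq> []" "set (vwalk_arcs ys) \<subseteq> parcs D" "s + length ys = Suc k"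
      "hd ys \<in> pverts Cr" "set (tl ys) \<inter> pverts Cr = {}" "last ys = j"
      "level_weight A s ys = from_crit j" by (rule opt_from_crit_attained[OF fin(2)])
    have gap: "length xs + length ys + Sch g q \<le> k + 2"
      by (rule optimal_walks_gap[OF xs ys fin]) (use b1[of i j] in \<open>simp add: u lam n q Nc\<close>)
    \<comment> \<open>\<open>m\<close> and \<open>m'\<close> are the numbers of steps of the two
      optimal walks, and \<open>l\<close> is the number of levels left between them.\<close>
    define m m' l where "m = length xs - 1" and "m' = length ys - 1" and "l = s - m"
    have len: "length xs = Suc m" "length ys = Suc m'" using xs(1) ys(1) by (simp_all add: m_def m'_def)
    have l: "m + l + m' = k" "Sch g q \<le> l" "s = m + l" using gap ys(3) len unfolding l_def by linarith+
    have cx: "[c (last xs) = c i + m] (mod g)"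
      using cl[OF vwalk_arcs_relpow[OF xs(1,2)]] xs(6) len by simp
    have cy: "[c j = c (hd ys) + m'] (mod g)"
      using cl[OF vwalk_arcs_relpow[OF ys(1,2)]] ys(6) len by simp
    have cab: "[c a = c i + k] (mod g)" "[c j = c b + k] (mod g)" "[c b = c a + L] (mod g)"
      using G_cong Gab clE[OF ab] by auto
    \<comment> \<open>No product walk from \<open>i\<close> to \<open>j\<close> is available yet.
      The residue of the gap is computed along the CSR walk through \<open>a\<close> and
      \<open>b\<close> instead, where \<open>L + k\<close> cancels modulo \<open>g\<close>.\<close>
    have "[c (hd ys) + m' = c j] (mod g)" using cy by (rule cong_sym)
    also have "[c j = c b + k] (mod g)" by (rule cab)
    also have "[c b + k = (c a + L) + k] (mod g)" using cab(3) by (simp only: cong_add_rcancel_nat)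
    also have "(c a + L) + k = c a + (L + k)" by simp
    also have "[c a + (L + k) = c a + 0] (mod g)" by (rule cong_add[OF cong_refl Lk])
    also have "c a + 0 = c a" by simp
    also have "[c a = c i + k] (mod g)" by (rule cab)
    also have "c i + k = ((c i + m) + l) + m'" using l(1) by simp
    also have "[((c i + m) + l) + m' = (c (last xs) + l) + m'] (mod g)"
      using cong_sym[OF cx] by (simp only: cong_add_rcancel_nat)
    finally have "[c (hd ys) = c (last xs) + l] (mod g)" by (simp only: cong_add_rcancel_nat)
    then have "(last xs, hd ys) \<in> ?E ^^ l" using sch[OF xs(4) ys(4) l(2)] by blast
    then have "level_weight A 0 xs + level_weight A (Suc k - length ys) ys \<le> ?G $ hd xs $ last ys"
      by (rule product_fill[OF xs(1) ys(1)]) (use len l in simp)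
    moreover have "Suc k - length ys = s" using ys(3) by linarith
    ultimately have "to_crit i + from_crit j \<le> ?G $ i $ j" using xs(6,7) ys(6,7) by simp
    then show ?thesis using csr_le by (rule order_trans[rotated])
  qed simp
  show ?thesis unfolding vec_eq_iff using le ge by (auto intro: antisym)
qed

end
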